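(* Let $k,n,p$ be integers, $n\ge 1$, $k\ge 0$, $p\ge 0$, let $\alpha(x,\xi)=\varepsilon+\mathrm{i}\kappa$ with constants $\varepsilon\ge 0$ and $\kappa\in\mathbb{R}$, and let $\mathcal{E}_{(k+n)(p+n)}$ be the field of angular $(p+n)$-moments of the non-stationary attenuated ray transform $u_{k+n}(t,x,\xi)$ of order $k+n$ of a function $f(t,x,\xi)$. Then $$\delta^n\mathcal{E}_{(k+n)(p+n)}=\sum_{j=0}^n(-1)^j\binom{n}{j}\frac{(k+n)!}{(k+j)!}\Big(\frac{\partial}{\partial t}+\alpha\Big)^j\mathcal{E}_{(k+j)p},\qquad k\ge 1,$$ and, for the field $\mathcal{E}_{0(p+n)}$ of angular $(p+n)$-moments of the non-stationary attenuated ray transform $u_0(t,x,\xi)$ of order $0$ of $f$, $$\delta^n\mathcal{E}_{0(p+n)}=\sum_{j=0}^{n-1}(-1)^j\Big(\frac{\partial}{\partial t}+\alpha\Big)^j\big(\mathcal{H}^{n-j-1}f\big)_p+(-1)^n\Big(\frac{\partial}{\partial t}+\alpha\Big)^n\mathcal{E}_{0p}.$$ Here $\mathcal{H}^{n-j-1}$ is a power of the operator $\mathcal{H}$, $(\mathcal{H}^{n-j-1}f)_p$ is the angular $p$-moment of the function $\mathcal{H}^{n-j-1}f$, and $(\mathcal{H}^0f)_p=f_p$.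
   Context: $D\subset\mathbb{R}^3$ is a bounded convex domain with smooth boundary, $\mathbb{S}^2$ is the unit sphere of $\mathbb{R}^3$, and $\mathbb{S}D=\{(x,\xi): x\in D,\ \xi\in\mathbb{S}^2\}$. The function $f\in C^n(\mathbb{R}\times\mathbb{S}D)$ is bounded and finite with respect to $x$, i.e. it vanishes for $x$ outside some compact subset of $D$; it is extended by zero to all $x\in\mathbb{R}^3$. For constant $\alpha$, the non-stationary attenuated ray transform (ART) of order $k\ge 0$ of $f$ is $$u_k(t,x,\xi)=\int_0^\infty s^k e^{-\alpha s} f(t-s,x-s\xi,\xi)\,ds .$$ Its integral angular $p$-moment is the time-dependent symmetric $p$-tensor field $\mathcal{E}_{kp}$ with components $$\mathcal{E}_{kp}^{i_1\ldots i_p}(t,x)=\int_{\mathbb{S}^2}u_k(t,x,\xi)\,\xi^{i_1}\cdots\xi^{i_p}\,d\lambda(\xi),\qquad p\ge 0,$$ where $\xi^i$ are the components of $\xi$ and $d\lambda$ is the angular (surface) measure on the unit sphere. The angular $p$-moment of a function $g(t,x,\xi)$ is the symmetric $p$-tensor field $g_p$ with components $g_p^{i_1\ldots i_p}(t,x)=\int_{\mathbb{S}^2}g(t,x,\xi)\,\xi^{i_1}\cdots\xi^{i_p}\,d\lambda(\xi)$. The operator $\mathcal{H}$ is $(\mathcal{H}\psi)(t,x,\xi)=\frac{d}{d\tau}\psi(t,x+\tau\xi,\xi)\big|_{\tau=0}=\sum_{j=1}^3\xi^j\frac{\partial\psi}{\partial x^j}(t,x,\xi)$. The divergence $\delta$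 (in $x$) maps symmetric tensor fields of rank $m+1$ to symmetric tensor fields of rank $m$: $(\delta w)_{j_1\ldots j_m}=\sum_{q=1}^3\frac{\partial w_{j_1\ldots j_m q}}{\partial x^q}$; $\delta^n$ is its $n$-fold iteration. (Upper and lower indices are not distinguished in Cartesian coordinates.) *)

theory Defs
  imports "HOL-Analysis.Analysis"
begin

text \<open>
  \<open>Ck_on n g U\<close>: \<open>g\<close> is of class \<open>C\<^sup>n\<close> on \<open>U\<close>. The derivatives are taken in the full
  space, so this is meant for open \<open>U\<close> only; other sets are handled by \<open>Ck_on_subset\<close>.
\<close>

primrec Ck_on :: "nat \<Rightarrow> ('a::euclidean_space \<Rightarrow> 'b::real_normed_vector) \<Rightarrow> 'a set \<Rightarrow> bool" where
  "Ck_on 0 g U \<longleftrightarrow> continuous_on U g"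
| "Ck_on (Suc n) g U \<longleftrightarrow>
     (\<forall>x\<in>U. g differentiable (at x)) \<and>
     (\<forall>v. Ck_on n (\<lambda>x. frechet_derivative g (at x) v) U)"

text \<open>
  Class \<open>C\<^sup>n\<close> on a subset of Euclidean space, by local extension to open sets. On an embedded
  submanifold, such as the product of an open set and a sphere, this is the usual notion.
\<close>

definition Ck_on_subset ::
  "nat \<Rightarrow> ('a::euclidean_space \<Rightarrow> 'b::real_normed_vector) \<Rightarrow> 'a set \<Rightarrow> bool" where
  "Ck_on_subset n g S \<longleftrightarrow>
     (\<forall>z\<in>S. \<exists>U h. open U \<and> z \<in> U \<and> Ck_on n h U \<and> (\<forall>y\<in>U \<inter> S. g y = h y))"

text \<open>Near each boundary point, \<open>D\<close> is a sublevel set of a smooth function without critical points.\<close>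

definition smooth_boundary :: "'a::euclidean_space set \<Rightarrow> bool" where
  "smooth_boundary D \<longleftrightarrow>
     (\<forall>z\<in>frontier D. \<exists>U (\<rho> :: 'a \<Rightarrow> real).
        open U \<and> z \<in> U \<and> (\<forall>m. Ck_on m \<rho> U) \<and>
        (\<forall>x\<in>U. frechet_derivative \<rho> (at x) \<noteq> (\<lambda>v. 0)) \<and>
        D \<inter> U = {x \<in> U. \<rho> x < 0})"

text \<open>
  Surface measure on the unit sphere of 3-space in spherical coordinates: the image of
  \<open>sin \<theta> d\<theta> d\<phi>\<close> on \<open>[0, \<pi>] \<times> [0, 2\<pi>]\<close>. Its \<open>\<sigma>\<close>-algebra is restricted to the sphere, so
  that the values of an integrand off the sphere matter neither for its integral nor for its
  measurability.
\<close>

definition spherical :: "real \<times> real \<Rightarrow> real ^ 3" where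
  "spherical = (\<lambda>(\<theta>, \<phi>). vector [sin \<theta> * cos \<phi>, sin \<theta> * sin \<phi>, cos \<theta>])"

definition sphere_measure :: "(real ^ 3) measure" where
  "sphere_measure =
     distr
       (density lborel
          (\<lambda>(\<theta>, \<phi>). ennreal (indicator ({0..pi} \<times> {0..2 * pi}) (\<theta>, \<phi>) * sin \<theta>)))
       (restrict_space borel (sphere 0 1)) spherical"

text \<open>The non-stationary attenuated ray transform \<open>u\<^sub>k\<close> of \<open>f\<close> with constant \<open>\<alpha>\<close>.\<close>

definition ART ::
  "complex \<Rightarrow> (real \<Rightarrow> real ^ 3 \<Rightarrow> real ^ 3 \<Rightarrow> complex) \<Rightarrow> nat
     \<Rightarrow> real \<Rightarrow> real ^ 3 \<Rightarrow> real ^ 3 \<Rightarrow> complex" where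
  "ART \<alpha> f k t x \<xi> =
     (LINT s:{0..}|lborel.
        of_real (s ^ k) * exp (- \<alpha> * of_real s) * f (t - s) (x - s *\<^sub>R \<xi>) \<xi>)"

text \<open>
  A time-dependent tensor field is given by its components: a component of rank \<open>p\<close> is selected by
  a list of \<open>p\<close> indices. A field of rank \<open>p\<close> is set to 0 on lists of any other length.
\<close>

type_synonym tensor_field = "real \<Rightarrow> real ^ 3 \<Rightarrow> 3 list \<Rightarrow> complex"

definition angular_moment ::
  "nat \<Rightarrow> (real \<Rightarrow> real ^ 3 \<Rightarrow> real ^ 3 \<Rightarrow> complex) \<Rightarrow> tensor_field" where
  "angular_moment p g t x is =
     (if length is = p
      then LINT \<xi>|sphere_measure. g t x \<xi> * of_real (\<Prod>i\<leftarrow>is. \<xi> $ i)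
      else 0)"

text \<open>\<open>\<E>\<^sub>k\<^sub>p\<close>\<close>

definition ART_moment ::
  "complex \<Rightarrow> (real \<Rightarrow> real ^ 3 \<Rightarrow> real ^ 3 \<Rightarrow> complex) \<Rightarrow> nat \<Rightarrow> nat \<Rightarrow> tensor_field" where
  "ART_moment \<alpha> f k p = angular_moment p (ART \<alpha> f k)"

definition ray_derivative ::
  "(real \<Rightarrow> real ^ 3 \<Rightarrow> real ^ 3 \<Rightarrow> complex) \<Rightarrow> real \<Rightarrow> real ^ 3 \<Rightarrow> real ^ 3 \<Rightarrow> complex" where
  "ray_derivative \<psi> t x \<xi> = vector_derivative (\<lambda>\<tau>. \<psi> t (x + \<tau> *\<^sub>R \<xi>) \<xi>) (at 0)"

definition divergence :: "tensor_field \<Rightarrow> tensor_field" where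
  "divergence w t x js =
     (\<Sum>q\<in>UNIV. vector_derivative (\<lambda>h. w t (x + h *\<^sub>R axis q 1) (js @ [q])) (at 0))"

text \<open>The operator \<open>\<partial>/\<partial>t + \<alpha>\<close>.\<close>

definition dt_plus :: "complex \<Rightarrow> tensor_field \<Rightarrow> tensor_field" where
  "dt_plus \<alpha> w t x is = vector_derivative (\<lambda>\<tau>. w \<tau> x is) (at t) + \<alpha> * w t x is"

end

theory Submission
  imports Defs
begin

text \<open>
  The proof rests on one transport identity and on translation invariance.

  Write \<open>H\<close> for the derivative along the ray and \<open>A = \<partial>/\<partial>t + \<alpha>\<close>. On the ray through \<open>(t, x)\<close>
  with direction \<open>\<xi>\<close>, the function \<open>s \<mapsto> f (t - s) (x - s \<xi>) \<xi>\<close> has derivative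
  \<open>- (\<partial>/\<partial>t + H) f\<close>, so integrating the derivative of \<open>s\<^sup>k e\<^sup>-\<^sup>\<alpha>\<^sup>s f\<close> from 0 to infinity gives
  \<open>ART\<^sub>k (H f) = k ART\<^sub>k\<^sub>-\<^sub>1 f - ART\<^sub>k (A f)\<close>, where the first term on the right is \<open>f\<close> itself if
  \<open>k = 0\<close> (\<open>ART_transport\<close>).

  The transform and the moments have kernels that are translation invariant in \<open>(t, x)\<close>, so
  derivatives in \<open>(t, x)\<close> pass through both integrals onto \<open>f\<close>. A divergence of a moment sums
  \<open>\<xi>\<^sup>q \<partial>\<^sub>q\<close> and thus acts on \<open>f\<close> as \<open>H\<close> while it lowers the rank by one
  (\<open>divergence_ART_moment\<close>); the operator \<open>\<partial>/\<partial>t + \<alpha>\<close> on a moment acts on \<open>f\<close> as \<open>A\<close>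
  (\<open>dt_plus_ART_moment\<close>). Therefore the left-hand sides are the moments of \<open>ART\<^sub>k\<^sub>+\<^sub>n (H\<^sup>n f)\<close> and
  of \<open>ART\<^sub>0 (H\<^sup>n f)\<close>.

  Applying the transport identity to \<open>H\<^sup>n f\<close> expresses level \<open>n + 1\<close> by level \<open>n\<close>, and the two
  formulas follow by induction on \<open>n\<close>; the binomial coefficients come from Pascal's rule. In this
  order the outermost operator is always \<open>A\<close>, so \<open>A\<close> and \<open>H\<close> are never interchanged and no
  derivative of order above \<open>n\<close> occurs.

  Throughout, \<open>f\<close> is a function on \<open>\<real> \<times> \<real>\<^sup>3 \<times> S\<^sup>2\<close> that has local \<open>C\<^sup>n\<close> extensions off the
  sphere and vanishes for \<open>x\<close> outside a compact set \<open>K\<close>. The compactness of \<open>K\<close> makes every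
  ray integral an integral over an interval \<open>[0, L]\<close> with \<open>L\<close> locally uniform in \<open>x\<close>, and
  spherical coordinates make every angular integral an integral over a rectangle, so that the
  Leibniz rule for compact boxes suffices.
\<close>

section \<open>Functions of class \<open>C\<^sup>n\<close>\<close>

lemma Ck_on_cong:
  assumes "open U" and "\<And>x. x \<in> U \<Longrightarrow> g x = h x" and "Ck_on n g U"
  shows "Ck_on n h U"
  using assms(2,3)
proof (induction n arbitrary: g h)
  case 0
  then show ?case by (metis Ck_on.simps(1) continuous_on_cong)
next
  case (Suc n)
  have D: "(h has_derivative frechet_derivative g (at x)) (at x)" if "x \<in> U" for x
  proof (rule has_derivative_transform_within_open[OF _ \<open>open U\<close> that])
    show "(g has_derivative frechet_derivative g (at x)) (at x)"
      using Suc.prems(2) that frechet_derivative_works by auto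
  qed (use Suc.prems(1) in auto)
  have "frechet_derivative h (at x) = frechet_derivative g (at x)" if "x \<in> U" for x
    using D[OF that] frechet_derivative_at by metis
  then have "Ck_on n (\<lambda>x. frechet_derivative h (at x) v) U" for v
    using Suc.IH[of "\<lambda>x. frechet_derivative g (at x) v" "\<lambda>x. frechet_derivative h (at x) v"]
      Suc.prems(2) by simp
  then show ?case
    using D by (auto simp: differentiable_def)
qed

lemma Ck_on_mono:
  assumes "V \<subseteq> U" and "Ck_on n g U"
  shows "Ck_on n g V"
  using assms(2)
proof (induction n arbitrary: g)
  case 0
  then show ?case using assms(1) continuous_on_subset by auto
next
  case (Suc n)
  then show ?case using assms(1) by auto
qed

lemma Ck_on_SucD: "Ck_on (Suc n) g U \<Longrightarrow> Ck_on n g U"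
proof (induction n arbitrary: g)
  case 0
  then show ?case
    by (auto intro!: continuous_at_imp_continuous_on differentiable_imp_continuous_within)
next
  case (Suc n)
  have "g differentiable (at x)" if "x \<in> U" for x
    using Suc.prems that by simp
  moreover have "Ck_on n (\<lambda>x. frechet_derivative g (at x) v) U" for v
    by (rule Suc.IH) (use Suc.prems in simp)
  ultimately show ?case by simp
qed

text \<open>
  Knowing any formula for the derivative suffices; this is how the closure properties below are
  reduced to the product and chain rules.
\<close>

lemma Ck_on_SucI:
  assumes "open U" and "\<And>x. x \<in> U \<Longrightarrow> (g has_derivative g' x) (at x)"
    and "\<And>v. Ck_on n (\<lambda>x. g' x v) U"
  shows "Ck_on (Suc n) g U"
proof -
  have "g' x v = frechet_derivative g (at x) v" if "x \<in> U" for x v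
    using frechet_derivative_at[OF assms(2)[OF that]] by (rule fun_cong)
  then have "Ck_on n (\<lambda>x. frechet_derivative g (at x) v) U" for v
    by (rule Ck_on_cong[OF assms(1) _ assms(3)])
  moreover have "g differentiable (at x)" if "x \<in> U" for x
    using assms(2)[OF that] by (rule differentiableI)
  ultimately show ?thesis by simp
qed

lemma Ck_on_Suc_has_derivative:
  "Ck_on (Suc n) g U \<Longrightarrow> x \<in> U \<Longrightarrow> (g has_derivative frechet_derivative g (at x)) (at x)"
  using frechet_derivative_works by auto

lemma Ck_on_Suc_frechet: "Ck_on (Suc n) g U \<Longrightarrow> Ck_on n (\<lambda>x. frechet_derivative g (at x) v) U"
  by simp

lemma Ck_on_zero: "Ck_on n (\<lambda>_. 0) U"
  by (induction n) auto

lemma Ck_on_linear_image: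
  assumes "open U" and "bounded_linear L" and "Ck_on n g U"
  shows "Ck_on n (\<lambda>x. L (g x)) U"
  using assms(3)
proof (induction n arbitrary: g)
  case 0
  then show ?case
    using bounded_linear.continuous_on[OF assms(2)] by simp
next
  case (Suc n)
  show ?case
  proof (rule Ck_on_SucI[OF assms(1)])
    show "((\<lambda>x. L (g x)) has_derivative (\<lambda>v. L (frechet_derivative g (at x) v))) (at x)"
      if "x \<in> U" for x
      by (rule bounded_linear.has_derivative[OF assms(2) Ck_on_Suc_has_derivative[OF Suc.prems that]])
    show "Ck_on n (\<lambda>x. L (frechet_derivative g (at x) v)) U" for v
      by (rule Suc.IH[OF Ck_on_Suc_frechet[OF Suc.prems]])
  qed
qed

lemma Ck_on_add:
  assumes "open U" and "Ck_on n g U" and "Ck_on n h U"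
  shows "Ck_on n (\<lambda>x. g x + h x) U"
  using assms(2,3)
proof (induction n arbitrary: g h)
  case 0
  then show ?case by (simp add: continuous_on_add)
next
  case (Suc n)
  show ?case
  proof (rule Ck_on_SucI[OF assms(1)])
    show "((\<lambda>x. g x + h x) has_derivative
        (\<lambda>v. frechet_derivative g (at x) v + frechet_derivative h (at x) v)) (at x)"
      if "x \<in> U" for x
      by (intro has_derivative_add Ck_on_Suc_has_derivative[OF Suc.prems(1) that]
            Ck_on_Suc_has_derivative[OF Suc.prems(2) that])
    show "Ck_on n (\<lambda>x. frechet_derivative g (at x) v + frechet_derivative h (at x) v) U" for v
      by (intro Suc.IH Ck_on_Suc_frechet[OF Suc.prems(1)] Ck_on_Suc_frechet[OF Suc.prems(2)])
  qed
qed

text \<open>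
  Linear scalar factors are all that is needed to handle multiplication by the coordinates of
  the direction. Since the derivative of a linear factor is constant, the induction closes
  without a product rule for two general \<open>C\<^sup>n\<close> functions.
\<close>

lemma Ck_on_scaleR_linear:
  assumes "open U" and "bounded_linear l" and "Ck_on n g U"
  shows "Ck_on n (\<lambda>x. l x *\<^sub>R g x) U"
  using assms(3)
proof (induction n arbitrary: g)
  case 0
  then show ?case
    using linear_continuous_on[OF assms(2)] by (simp add: continuous_on_scaleR)
next
  case (Suc n)
  show ?case
  proof (rule Ck_on_SucI[OF assms(1)])
    show "((\<lambda>x. l x *\<^sub>R g x) has_derivative
        (\<lambda>v. l x *\<^sub>R frechet_derivative g (at x) v + l v *\<^sub>R g x)) (at x)"
      if "x \<in> U" for x
      by (intro has_derivative_scaleR bounded_linear_imp_has_derivative assms(2)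
            Ck_on_Suc_has_derivative[OF Suc.prems that])
    show "Ck_on n (\<lambda>x. l x *\<^sub>R frechet_derivative g (at x) v + l v *\<^sub>R g x) U" for v
      by (intro Ck_on_add assms(1) Suc.IH Ck_on_Suc_frechet[OF Suc.prems]
            Ck_on_linear_image[OF _ bounded_linear_scaleR_right] Ck_on_SucD[OF Suc.prems])
  qed
qed

lemma Ck_on_subset_cong:
  assumes "\<And>z. z \<in> S \<Longrightarrow> g z = h z" and "Ck_on_subset n g S"
  shows "Ck_on_subset n h S"
  unfolding Ck_on_subset_def
  using assms by (metis Ck_on_subset_def IntD2)

lemma Ck_on_subset_SucD: "Ck_on_subset (Suc n) g S \<Longrightarrow> Ck_on_subset n g S"
  unfolding Ck_on_subset_def using Ck_on_SucD by metis

lemma Ck_on_subset_add: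
  assumes "Ck_on_subset n g S" and "Ck_on_subset n h S"
  shows "Ck_on_subset n (\<lambda>z. g z + h z) S"
  unfolding Ck_on_subset_def
proof
  fix z assume "z \<in> S"
  then obtain U g' V h' where
    "open U" "z \<in> U" "Ck_on n g' U" "\<forall>y\<in>U \<inter> S. g y = g' y"
    "open V" "z \<in> V" "Ck_on n h' V" "\<forall>y\<in>V \<inter> S. h y = h' y"
    using assms unfolding Ck_on_subset_def by metis
  then show "\<exists>W k. open W \<and> z \<in> W \<and> Ck_on n k W \<and> (\<forall>y\<in>W \<inter> S. g y + h y = k y)"
    by (intro exI[of _ "U \<inter> V"] exI[of _ "\<lambda>z. g' z + h' z"])
       (auto intro!: Ck_on_add intro: Ck_on_mono[of "U \<inter> V"])
qed

lemma Ck_on_subset_linear_image: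
  assumes "bounded_linear L" and "Ck_on_subset n g S"
  shows "Ck_on_subset n (\<lambda>z. L (g z)) S"
  unfolding Ck_on_subset_def
proof
  fix z assume "z \<in> S"
  then obtain U h where "open U" "z \<in> U" "Ck_on n h U" "\<forall>y\<in>U \<inter> S. g y = h y"
    using assms(2) unfolding Ck_on_subset_def by metis
  moreover have "Ck_on n (\<lambda>z. L (h z)) U"
    by (rule Ck_on_linear_image[OF \<open>open U\<close> assms(1) \<open>Ck_on n h U\<close>])
  ultimately show "\<exists>W k. open W \<and> z \<in> W \<and> Ck_on n k W \<and> (\<forall>y\<in>W \<inter> S. L (g y) = k y)"
    by (intro exI[of _ U] exI[of _ "\<lambda>z. L (h z)"]) simp
qed

lemma Ck_on_subset_scaleR_linear:
  assumes "bounded_linear l" and "Ck_on_subset n g S"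
  shows "Ck_on_subset n (\<lambda>z. l z *\<^sub>R g z) S"
  unfolding Ck_on_subset_def
proof
  fix z assume "z \<in> S"
  then obtain U h where "open U" "z \<in> U" "Ck_on n h U" "\<forall>y\<in>U \<inter> S. g y = h y"
    using assms(2) unfolding Ck_on_subset_def by metis
  moreover have "Ck_on n (\<lambda>z. l z *\<^sub>R h z) U"
    by (rule Ck_on_scaleR_linear[OF \<open>open U\<close> assms(1) \<open>Ck_on n h U\<close>])
  ultimately show "\<exists>W k. open W \<and> z \<in> W \<and> Ck_on n k W \<and> (\<forall>y\<in>W \<inter> S. l y *\<^sub>R g y = k y)"
    by (intro exI[of _ U] exI[of _ "\<lambda>z. l z *\<^sub>R h z"]) simp
qed

lemma continuous_on_if_Ck_on_subset:
  assumes "Ck_on_subset n g S"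
  shows "continuous_on S g"
proof -
  have "Ck_on_subset 0 g S"
    using assms by (induction n) (auto dest: Ck_on_subset_SucD)
  show ?thesis
    unfolding continuous_on_eq_continuous_within
  proof
    fix z assume z: "z \<in> S"
    then obtain U h where U: "open U" "z \<in> U" "continuous_on U h" "\<forall>y\<in>U \<inter> S. g y = h y"
      using \<open>Ck_on_subset 0 g S\<close> unfolding Ck_on_subset_def by (metis Ck_on.simps(1))
    have "continuous_on (U \<inter> S) g"
      using U by (metis continuous_on_cong continuous_on_subset inf_le1)
    then have "continuous (at z within U \<inter> S) g"
      using z U(2) by (simp add: continuous_on_eq_continuous_within)
    moreover have "at z within U \<inter> S = at z within S"
      by (rule at_within_nhd[OF U(2,1)]) auto
    ultimately show "continuous (at z within S) g" by simp
  qed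
qed

section \<open>Finite functions on the unit sphere bundle and their partial derivatives\<close>

abbreviation unit_bundle :: "(real \<times> (real ^ 3) \<times> (real ^ 3)) set" where
  "unit_bundle \<equiv> UNIV \<times> UNIV \<times> sphere 0 1"

text \<open>
  The class of the source \<open>f\<close> and of its derivatives under \<open>H\<close> and \<open>A\<close>. The values off the
  sphere are left arbitrary, because neither the transform nor the moments see them.
\<close>

definition finite_Ck ::
  "(real ^ 3) set \<Rightarrow> nat \<Rightarrow> (real \<Rightarrow> real ^ 3 \<Rightarrow> real ^ 3 \<Rightarrow> complex) \<Rightarrow> bool" where
  "finite_Ck K n g \<longleftrightarrow>
     Ck_on_subset n (\<lambda>(t, x, \<xi>). g t x \<xi>) unit_bundle \<and>
     (\<forall>t x. \<forall>\<xi>\<in>sphere 0 1. x \<notin> K \<longrightarrow> g t x \<xi> = 0)"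

text \<open>
  Partial derivatives are taken in \<open>(t, x)\<close> only, with the direction frozen: derivatives
  transversal to the sphere would depend on the choice of an extension.
\<close>

definition partial ::
  "real \<times> (real ^ 3) \<Rightarrow> (real \<Rightarrow> real ^ 3 \<Rightarrow> real ^ 3 \<Rightarrow> complex) \<Rightarrow> real \<Rightarrow> real ^ 3 \<Rightarrow> real ^ 3 \<Rightarrow> complex"
  where "partial v g t x \<xi> = frechet_derivative (\<lambda>(t, x). g t x \<xi>) (at (t, x)) v"

text \<open>
  With the direction fixed on the sphere, a neighbourhood of \<open>(t, x)\<close> stays inside the domain of
  the local extension, so the derivative of the slice is that of the extension restricted to
  vectors with vanishing third component.
\<close>

lemma slice_has_derivative:
  assumes "open U" and "(t, x, \<xi>) \<in> U" and "\<xi> \<in> sphere 0 1"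
    and h: "(h has_derivative h') (at (t, x, \<xi>))"
    and gh: "\<forall>y\<in>U \<inter> unit_bundle. (\<lambda>(t, x, \<xi>). g t x \<xi>) y = h y"
  shows "((\<lambda>(t, x). g t x \<xi>) has_derivative (\<lambda>v. h' (fst v, snd v, 0))) (at (t, x))"
proof -
  let ?i = "\<lambda>z :: real \<times> (real ^ 3). (fst z, snd z, \<xi>)"
  have i: "(?i has_derivative (\<lambda>v. (fst v, snd v, 0))) (at (t, x))"
    by (auto intro!: derivative_eq_intros)
  have "((\<lambda>z. h (?i z)) has_derivative (\<lambda>v. h' (fst v, snd v, 0))) (at (t, x))"
    by (rule has_derivative_compose[OF i]) (simp add: h)
  then show ?thesis
  proof (rule has_derivative_transform_within_open)
    show "open (?i -` U)"
      by (rule open_vimage[OF \<open>open U\<close>]) (intro continuous_intros)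
    show "h (?i z) = (case z of (t, x) \<Rightarrow> g t x \<xi>)" if "z \<in> ?i -` U" for z
      using bspec[OF gh, of "?i z"] that assms(3) by (simp add: case_prod_unfold)
  qed (use assms(2) in simp)
qed

text \<open>
  The partial derivative is locally the restriction of a directional derivative of the extension,
  which is of class \<open>C\<^sup>n\<close>; and it vanishes off \<open>K\<close> since the complement of \<open>K\<close> is open.
\<close>

lemma
  assumes "finite_Ck K (Suc n) g" and "closed K"
  shows partial_works: "\<xi> \<in> sphere 0 1 \<Longrightarrow>
      ((\<lambda>(t, x). g t x \<xi>) has_derivative (\<lambda>v. partial v g t x \<xi>)) (at (t, x))"
    and finite_Ck_partial: "finite_Ck K n (partial v g)"
proof -
  have local_rep: "\<exists>U h. open U \<and> z \<in> U \<and> Ck_on (Suc n) h U \<and>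
      (\<forall>y\<in>U \<inter> unit_bundle. (\<lambda>(t, x, \<xi>). g t x \<xi>) y = h y)" if "z \<in> unit_bundle" for z
    using assms(1) that unfolding finite_Ck_def Ck_on_subset_def by blast
  show works: "((\<lambda>(t, x). g t x \<xi>) has_derivative (\<lambda>v. partial v g t x \<xi>)) (at (t, x))"
    if "\<xi> \<in> sphere 0 1" for t x \<xi>
  proof -
    from that have "(t, x, \<xi>) \<in> unit_bundle" by simp
    then obtain U h where U: "open U" "(t, x, \<xi>) \<in> U" "Ck_on (Suc n) h U"
      "\<forall>y\<in>U \<inter> unit_bundle. (\<lambda>(t, x, \<xi>). g t x \<xi>) y = h y"
      using local_rep by blast
    show ?thesis
      unfolding partial_def
      using slice_has_derivative[OF U(1,2) that Ck_on_Suc_has_derivative[OF U(3,2)] U(4)]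
      by (intro frechet_derivative_works[THEN iffD1] differentiableI)
  qed
  have "Ck_on_subset n (\<lambda>(t, x, \<xi>). partial v g t x \<xi>) unit_bundle"
    unfolding Ck_on_subset_def
  proof
    fix z assume "z \<in> unit_bundle"
    then obtain U h where U: "open U" "z \<in> U" "Ck_on (Suc n) h U"
      "\<forall>y\<in>U \<inter> unit_bundle. (\<lambda>(t, x, \<xi>). g t x \<xi>) y = h y"
      using local_rep by blast
    have "(\<lambda>(t, x, \<xi>). partial v g t x \<xi>) y = frechet_derivative h (at y) (fst v, snd v, 0)"
      if y: "y \<in> U \<inter> unit_bundle" for y
    proof -
      obtain t x \<xi> where y_eq: "y = (t, x, \<xi>)" by (metis prod.collapse)
      then have "(t, x, \<xi>) \<in> U" "\<xi> \<in> sphere 0 1" using y by auto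
      note slice_has_derivative[OF U(1) this Ck_on_Suc_has_derivative[OF U(3) this(1)] U(4)]
      from fun_cong[OF frechet_derivative_at[OF this], of v] show ?thesis
        unfolding y_eq partial_def by simp
    qed
    moreover have "Ck_on n (\<lambda>y. frechet_derivative h (at y) (fst v, snd v, 0)) U"
      by (rule Ck_on_Suc_frechet[OF U(3)])
    ultimately show "\<exists>U h. open U \<and> z \<in> U \<and> Ck_on n h U \<and>
        (\<forall>y\<in>U \<inter> unit_bundle. (\<lambda>(t, x, \<xi>). partial v g t x \<xi>) y = h y)"
      using U(1,2) by blast
  qed
  moreover have "partial v g t x \<xi> = 0" if "\<xi> \<in> sphere 0 1" "x \<notin> K" for t x \<xi>
  proof -
    have "((\<lambda>(t, x). g t x \<xi>) has_derivative (\<lambda>v. 0)) (at (t, x))"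
    proof (rule has_derivative_transform_within_open)
      show "open (UNIV \<times> - K)" using \<open>closed K\<close> by (simp add: open_Times open_Compl)
      show "((\<lambda>_. 0) has_derivative (\<lambda>v. 0)) (at (t, x))" by simp
    qed (use assms(1) that in \<open>auto simp: finite_Ck_def\<close>)
    then show ?thesis
      unfolding partial_def by (metis frechet_derivative_at)
  qed
  ultimately show "finite_Ck K n (partial v g)"
    unfolding finite_Ck_def by auto
qed

lemma finite_Ck_SucD: "finite_Ck K (Suc n) g \<Longrightarrow> finite_Ck K n g"
  unfolding finite_Ck_def using Ck_on_subset_SucD by blast

lemma finite_Ck_mono: "m \<le> n \<Longrightarrow> finite_Ck K n g \<Longrightarrow> finite_Ck K m g"
  by (induction n rule: dec_induct) (auto dest: finite_Ck_SucD)

lemma finite_Ck_continuous: "finite_Ck K n g \<Longrightarrow> continuous_on unit_bundle (\<lambda>(t, x, \<xi>). g t x \<xi>)"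
  unfolding finite_Ck_def using continuous_on_if_Ck_on_subset by blast

lemma finite_Ck_cong:
  assumes "finite_Ck K n g" and "\<And>t x \<xi>. \<xi> \<in> sphere 0 1 \<Longrightarrow> g t x \<xi> = h t x \<xi>"
  shows "finite_Ck K n h"
  using assms Ck_on_subset_cong[of unit_bundle "\<lambda>(t, x, \<xi>). g t x \<xi>" "\<lambda>(t, x, \<xi>). h t x \<xi>" n]
  unfolding finite_Ck_def by auto

lemma finite_Ck_add:
  assumes "finite_Ck K n g" and "finite_Ck K n h"
  shows "finite_Ck K n (\<lambda>t x \<xi>. g t x \<xi> + h t x \<xi>)"
  using assms Ck_on_subset_add[of n "\<lambda>(t, x, \<xi>). g t x \<xi>" unit_bundle "\<lambda>(t, x, \<xi>). h t x \<xi>"]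
  unfolding finite_Ck_def by (auto simp: case_prod_unfold)

lemma finite_Ck_mult_const:
  assumes "finite_Ck K n g"
  shows "finite_Ck K n (\<lambda>t x \<xi>. c * g t x \<xi>)"
  using assms
    Ck_on_subset_linear_image[OF bounded_linear_mult_right, of n "\<lambda>(t, x, \<xi>). g t x \<xi>" unit_bundle c]
  unfolding finite_Ck_def by (auto simp: case_prod_unfold)

lemma finite_Ck_mult_coordinate:
  assumes "finite_Ck K n g"
  shows "finite_Ck K n (\<lambda>t x \<xi>. of_real (\<xi> $ q) * g t x \<xi>)"
proof -
  have "bounded_linear (\<lambda>z :: real \<times> (real ^ 3) \<times> (real ^ 3). snd (snd z) $ q)"
    by (intro bounded_linear_compose[OF bounded_linear_vec_nth] bounded_linear_compose[OF bounded_linear_snd]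
        bounded_linear_snd)
  from Ck_on_subset_scaleR_linear[OF this, of n "\<lambda>(t, x, \<xi>). g t x \<xi>" unit_bundle]
  show ?thesis
    using assms unfolding finite_Ck_def by (auto simp: case_prod_unfold scaleR_conv_of_real)
qed

text \<open>
  Regularity over \<open>D\<close> becomes regularity over the whole space: points over \<open>D\<close> keep their local
  extension, and near points outside \<open>D\<close>, which lie off the closed set \<open>K\<close>, the zero function is
  one.
\<close>

lemma finite_Ck_zero_extension:
  assumes "Ck_on_subset n (\<lambda>(t, x, \<xi>). g t x \<xi>) (UNIV \<times> D \<times> sphere 0 1)"
    and "open D" and "closed K" and "K \<subseteq> D"
    and zero: "\<And>t x \<xi>. \<xi> \<in> sphere 0 1 \<Longrightarrow> x \<notin> K \<Longrightarrow> g t x \<xi> = 0"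
  shows "finite_Ck K n g"
proof -
  have "Ck_on_subset n (\<lambda>(t, x, \<xi>). g t x \<xi>) unit_bundle"
    unfolding Ck_on_subset_def
  proof
    fix z assume z: "z \<in> unit_bundle"
    obtain t x \<xi> where z_eq: "z = (t, x, \<xi>)" by (metis prod.collapse)
    show "\<exists>U h. open U \<and> z \<in> U \<and> Ck_on n h U \<and>
        (\<forall>y\<in>U \<inter> unit_bundle. (\<lambda>(t, x, \<xi>). g t x \<xi>) y = h y)"
    proof (cases "x \<in> D")
      case True
      then have "z \<in> UNIV \<times> D \<times> sphere 0 1" using z z_eq by auto
      then obtain U h where U: "open U" "z \<in> U" "Ck_on n h U"
        "\<forall>y\<in>U \<inter> UNIV \<times> D \<times> sphere 0 1. (\<lambda>(t, x, \<xi>). g t x \<xi>) y = h y"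
        using assms(1) unfolding Ck_on_subset_def by blast
      let ?V = "U \<inter> UNIV \<times> D \<times> UNIV"
      have "open ?V" using U(1) \<open>open D\<close> by (intro open_Int open_Times) auto
      moreover have "z \<in> ?V" using U(2) True z_eq by auto
      moreover have "Ck_on n h ?V" by (rule Ck_on_mono[OF _ U(3)]) auto
      moreover have "\<forall>y\<in>?V \<inter> unit_bundle. (\<lambda>(t, x, \<xi>). g t x \<xi>) y = h y"
        using U(4) by blast
      ultimately show ?thesis by blast
    next
      case False
      let ?V = "UNIV \<times> (- K) \<times> UNIV :: (real \<times> (real ^ 3) \<times> (real ^ 3)) set"
      have "open ?V" using \<open>closed K\<close> by (intro open_Times) auto
      moreover have "z \<in> ?V" using False z_eq \<open>K \<subseteq> D\<close> by auto
      moreover have "\<forall>y\<in>?V \<inter> unit_bundle. (\<lambda>(t, x, \<xi>). g t x \<xi>) y = 0"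
        using zero by auto
      ultimately show ?thesis using Ck_on_zero by blast
    qed
  qed
  then show ?thesis using zero unfolding finite_Ck_def by auto
qed

lemma partial_line_has_vector_derivative:
  assumes "finite_Ck K (Suc n) g" and "closed K" and "\<xi> \<in> sphere 0 1"
    and "(\<gamma> has_vector_derivative v) (at \<tau> within T)"
  shows "((\<lambda>\<tau>. g (fst (\<gamma> \<tau>)) (snd (\<gamma> \<tau>)) \<xi>) has_vector_derivative
      partial v g (fst (\<gamma> \<tau>)) (snd (\<gamma> \<tau>)) \<xi>) (at \<tau> within T)"
proof -
  have "((\<lambda>(t, x). g t x \<xi>) has_derivative (\<lambda>v. partial v g (fst (\<gamma> \<tau>)) (snd (\<gamma> \<tau>)) \<xi>))
      (at (\<gamma> \<tau>))"
    using partial_works[OF assms(1-3), of "fst (\<gamma> \<tau>)" "snd (\<gamma> \<tau>)"] by simp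
  then have "((\<lambda>(t, x). g t x \<xi>) has_derivative (\<lambda>v. partial v g (fst (\<gamma> \<tau>)) (snd (\<gamma> \<tau>)) \<xi>))
      (at (\<gamma> \<tau>) within \<gamma> ` T)"
    by (rule has_derivative_at_withinI)
  from vector_derivative_diff_chain_within[OF assms(4) this]
  show ?thesis by (simp add: o_def case_prod_unfold)
qed

lemma partial_linear:
  assumes "finite_Ck K (Suc n) g" and "closed K" and "\<xi> \<in> sphere 0 1"
  shows "linear (\<lambda>v. partial v g t x \<xi>)"
  using partial_works[OF assms] has_derivative_linear by blast

text \<open>
  The counterpart of \<open>\<partial>/\<partial>t + \<alpha>\<close> on sources instead of tensor fields.
\<close>

definition time_operator ::
  "complex \<Rightarrow> (real \<Rightarrow> real ^ 3 \<Rightarrow> real ^ 3 \<Rightarrow> complex) \<Rightarrow> real \<Rightarrow> real ^ 3 \<Rightarrow> real ^ 3 \<Rightarrow> complex"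
  where "time_operator \<alpha> g t x \<xi> = vector_derivative (\<lambda>\<tau>. g \<tau> x \<xi>) (at t) + \<alpha> * g t x \<xi>"

lemma time_operator_eq:
  assumes "finite_Ck K (Suc n) g" and "closed K" and "\<xi> \<in> sphere 0 1"
  shows "time_operator \<alpha> g t x \<xi> = partial (1, 0) g t x \<xi> + \<alpha> * g t x \<xi>"
proof -
  have "((\<lambda>\<tau>. (\<tau>, x)) has_vector_derivative (1, 0)) (at t)"
    by (auto intro!: derivative_eq_intros)
  from partial_line_has_vector_derivative[OF assms this]
  show ?thesis by (simp add: time_operator_def vector_derivative_at)
qed

lemma ray_derivative_eq:
  assumes "finite_Ck K (Suc n) g" and "closed K" and "\<xi> \<in> sphere 0 1"
  shows "ray_derivative g t x \<xi> = partial (0, \<xi>) g t x \<xi>"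
proof -
  have "((\<lambda>\<tau>. (t, x + \<tau> *\<^sub>R \<xi>)) has_vector_derivative (0, \<xi>)) (at 0)"
    by (auto intro!: derivative_eq_intros)
  from partial_line_has_vector_derivative[OF assms this]
  show ?thesis by (simp add: ray_derivative_def vector_derivative_at)
qed

text \<open>
  The coordinate form of the ray derivative is what connects it with the divergence.
\<close>

lemma ray_derivative_eq_sum:
  assumes "finite_Ck K (Suc n) g" and "closed K" and "\<xi> \<in> sphere 0 1"
  shows "ray_derivative g t x \<xi> = (\<Sum>q\<in>UNIV. of_real (\<xi> $ q) * partial (0, axis q 1) g t x \<xi>)"
proof -
  have "(0, \<xi>) = (\<Sum>q\<in>UNIV. (\<xi> $ q) *\<^sub>R (0 :: real, axis q 1 :: real ^ 3))"
    using basis_expansion[of \<xi>] by (simp add: prod_eq_iff fst_sum snd_sum scalar_mult_eq_scaleR)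
  then show ?thesis
    by (simp add: ray_derivative_eq[OF assms] linear_sum[OF partial_linear[OF assms]]
        linear_scale[OF partial_linear[OF assms]] scaleR_conv_of_real del: scaleR_Pair)
qed

lemma finite_Ck_time_operator:
  assumes "finite_Ck K (Suc n) g" and "closed K"
  shows "finite_Ck K n (time_operator \<alpha> g)"
proof (rule finite_Ck_cong)
  show "finite_Ck K n (\<lambda>t x \<xi>. partial (1, 0) g t x \<xi> + \<alpha> * g t x \<xi>)"
    by (intro finite_Ck_add finite_Ck_mult_const finite_Ck_partial[OF assms] finite_Ck_SucD[OF assms(1)])
qed (simp add: time_operator_eq[OF assms])

lemma finite_Ck_ray_derivative:
  assumes "finite_Ck K (Suc n) g" and "closed K"
  shows "finite_Ck K n (ray_derivative g)"
proof (rule finite_Ck_cong)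
  show "finite_Ck K n (\<lambda>t x \<xi>. of_real (\<xi> $ 1) * partial (0, axis 1 1) g t x \<xi> +
      (of_real (\<xi> $ 2) * partial (0, axis 2 1) g t x \<xi> +
       of_real (\<xi> $ 3) * partial (0, axis 3 1) g t x \<xi>))"
    by (intro finite_Ck_add finite_Ck_mult_coordinate finite_Ck_partial[OF assms])
qed (simp add: ray_derivative_eq_sum[OF assms] sum_3)

section \<open>Integration over the sphere\<close>

lemma spherical_in_sphere: "spherical \<omega> \<in> sphere 0 1"
proof -
  obtain \<theta> \<phi> where [simp]: "\<omega> = (\<theta>, \<phi>)" by fastforce
  have "spherical \<omega> \<bullet> spherical \<omega> = (sin \<theta> * cos \<phi>) * (sin \<theta> * cos \<phi>) +
      (sin \<theta> * sin \<phi>) * (sin \<theta> * sin \<phi>) + cos \<theta> * cos \<theta>"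
    by (simp add: spherical_def inner_vec_def sum_3)
  also have "\<dots> = 1"
    using sin_cos_squared_add[of \<theta>] sin_cos_squared_add[of \<phi>] by algebra
  finally show ?thesis by (simp add: norm_eq_1)
qed

lemma continuous_on_spherical: "continuous_on T spherical"
proof -
  have eq: "spherical = (\<lambda>\<omega>. \<chi> i. if i = 1 then sin (fst \<omega>) * cos (snd \<omega>)
      else if i = 2 then sin (fst \<omega>) * sin (snd \<omega>) else cos (fst \<omega>))"
    by (auto simp: fun_eq_iff spherical_def vec_eq_iff forall_3)
  have "continuous_on T (\<lambda>\<omega>. if i = 1 then sin (fst \<omega>) * cos (snd \<omega>)
      else if i = 2 then sin (fst \<omega>) * sin (snd \<omega>) else cos (fst \<omega>))" for i :: 3
    by (cases "i = 1"; cases "i = 2") (auto intro!: continuous_intros)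
  then show ?thesis unfolding eq by (rule continuous_on_vec_lambda)
qed

abbreviation angle_box :: "(real \<times> real) set" where
  "angle_box \<equiv> cbox (0, 0) (pi, 2 * pi)"

text \<open>
  For continuous integrands the surface integral is a Henstock--Kurzweil integral over a compact
  rectangle, which opens the way to the Leibniz rule for integrals over boxes.
\<close>

lemma
  fixes F :: "real ^ 3 \<Rightarrow> complex"
  assumes F: "continuous_on (sphere 0 1) F"
  shows sphere_integrable: "integrable sphere_measure F"
    and sphere_integral_eq:
      "(LINT \<xi>|sphere_measure. F \<xi>) =
       integral angle_box (\<lambda>\<omega>. sin (fst \<omega>) *\<^sub>R F (spherical \<omega>))"
proof -
  define w :: "real \<times> real \<Rightarrow> real" where
    "w = (\<lambda>\<omega>. indicator ({0..pi} \<times> {0..2 * pi}) \<omega> * sin (fst \<omega>))"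
  have measure_eq: "sphere_measure =
      distr (density lborel (\<lambda>\<omega>. ennreal (w \<omega>))) (restrict_space borel (sphere 0 1)) spherical"
    unfolding sphere_measure_def w_def by (simp add: case_prod_unfold)
  have w: "w \<in> borel_measurable lborel"
  proof -
    have "(\<lambda>\<omega>. sin (fst \<omega>)) \<in> borel_measurable (borel :: (real \<times> real) measure)"
      by (intro borel_measurable_continuous_onI continuous_intros)
    moreover have "{0..pi} \<times> {0..2 * pi} \<in> sets (borel :: (real \<times> real) measure)"
      by (intro borel_closed closed_Times) auto
    ultimately show ?thesis unfolding w_def by simp
  qed
  have w0: "AE \<omega> in lborel. 0 \<le> w \<omega>"
    by (auto simp: w_def indicator_def sin_ge_zero)
  have sph_borel: "spherical \<in> measurable borel (restrict_space borel (sphere 0 1))"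
    by (intro measurable_restrict_space2 borel_measurable_continuous_onI continuous_on_spherical)
       (use spherical_in_sphere in auto)
  then have sph: "spherical \<in> measurable (density lborel (\<lambda>\<omega>. ennreal (w \<omega>)))
      (restrict_space borel (sphere 0 1))"
    by simp
  have FM: "F \<in> borel_measurable (restrict_space borel (sphere 0 1))"
    by (rule borel_measurable_continuous_on_restrict[OF F])
  then have FS: "(\<lambda>\<omega>. F (spherical \<omega>)) \<in> borel_measurable lborel"
    using measurable_compose[OF sph_borel] by simp
  have box: "{0..pi} \<times> {0..2 * pi} = angle_box"
    by (simp add: cbox_Pair_eq)
  have set_form: "(\<lambda>\<omega>. w \<omega> *\<^sub>R F (spherical \<omega>)) =
      (\<lambda>\<omega>. indicator angle_box \<omega> *\<^sub>R (sin (fst \<omega>) *\<^sub>R F (spherical \<omega>)))"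
    by (simp add: w_def box)
  have int: "set_integrable lborel angle_box (\<lambda>\<omega>. sin (fst \<omega>) *\<^sub>R F (spherical \<omega>))"
    unfolding set_integrable_def
    by (intro borel_integrable_compact compact_cbox continuous_intros
          continuous_on_compose2[OF F continuous_on_spherical])
       (use spherical_in_sphere in auto)
  show "integrable sphere_measure F"
    unfolding measure_eq integrable_distr_eq[OF sph FM] integrable_density[OF FS w w0]
    using int by (simp add: set_form set_integrable_def)
  show "(LINT \<xi>|sphere_measure. F \<xi>) =
      integral angle_box (\<lambda>\<omega>. sin (fst \<omega>) *\<^sub>R F (spherical \<omega>))"
    unfolding measure_eq integral_distr[OF sph FM] integral_density[OF FS w w0]
    using set_borel_integral_eq_integral(2)[OF int]
    by (simp add: set_form set_lebesgue_integral_def)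
qed

lemma sphere_integral_has_vector_derivative:
  fixes G G' :: "real \<Rightarrow> real ^ 3 \<Rightarrow> complex"
  assumes G: "\<And>h. continuous_on (sphere 0 1) (G h)"
    and G': "continuous_on (UNIV \<times> sphere 0 1) (\<lambda>(h, \<xi>). G' h \<xi>)"
    and deriv: "\<And>h \<xi>. \<xi> \<in> sphere 0 1 \<Longrightarrow> ((\<lambda>h. G h \<xi>) has_vector_derivative G' h \<xi>) (at h)"
  shows "((\<lambda>h. LINT \<xi>|sphere_measure. G h \<xi>) has_vector_derivative
      (LINT \<xi>|sphere_measure. G' h \<xi>)) (at h)"
proof -
  have G'h: "continuous_on (sphere 0 1) (G' h)" for h
  proof -
    have "continuous_on (sphere 0 1) (\<lambda>\<xi>. (\<lambda>(h, \<xi>). G' h \<xi>) (h, \<xi>))"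
      by (rule continuous_on_compose2[OF G']) (auto intro!: continuous_intros)
    then show ?thesis by simp
  qed
  have "((\<lambda>h. integral angle_box (\<lambda>\<omega>. sin (fst \<omega>) *\<^sub>R G h (spherical \<omega>))) has_vector_derivative
      integral angle_box (\<lambda>\<omega>. sin (fst \<omega>) *\<^sub>R G' h (spherical \<omega>))) (at h within UNIV)"
  proof (rule leibniz_rule_vector_derivative)
    fix h :: real and \<omega> :: "real \<times> real"
    show "((\<lambda>h. sin (fst \<omega>) *\<^sub>R G h (spherical \<omega>)) has_vector_derivative
        sin (fst \<omega>) *\<^sub>R G' h (spherical \<omega>)) (at h within UNIV)"
      by (intro bounded_linear.has_vector_derivative[OF bounded_linear_scaleR_right]
            deriv spherical_in_sphere)
    show "(\<lambda>\<omega>. sin (fst \<omega>) *\<^sub>R G h (spherical \<omega>)) integrable_on angle_box"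
      by (intro integrable_continuous continuous_intros
            continuous_on_compose2[OF G continuous_on_spherical])
         (use spherical_in_sphere in auto)
  next
    have "continuous_on (UNIV \<times> angle_box) (\<lambda>z. (fst z, spherical (snd z)))"
      by (intro continuous_intros continuous_on_compose2[OF continuous_on_spherical[of UNIV]]) auto
    then have "continuous_on (UNIV \<times> angle_box)
        (\<lambda>z. (\<lambda>(h, \<xi>). G' h \<xi>) (fst z, spherical (snd z)))"
      by (rule continuous_on_compose2[OF G']) (use spherical_in_sphere in auto)
    then have "continuous_on (UNIV \<times> angle_box) (\<lambda>z. G' (fst z) (spherical (snd z)))"
      by simp
    then show "continuous_on (UNIV \<times> angle_box)
        (\<lambda>(h, \<omega>). sin (fst \<omega>) *\<^sub>R G' h (spherical \<omega>))"
      unfolding case_prod_unfold by (intro continuous_intros)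
  qed auto
  then show ?thesis
    by (simp add: sphere_integral_eq[OF G] sphere_integral_eq[OF G'h])
qed

section \<open>The attenuated ray transform of a finite function\<close>

lemma continuous_on_unit_bundle_compose:
  assumes "continuous_on unit_bundle (\<lambda>(t, x, \<xi>). u t x \<xi>)"
    and "continuous_on T a" and "continuous_on T b" and "continuous_on T c"
    and "\<And>z. z \<in> T \<Longrightarrow> c z \<in> sphere 0 1"
  shows "continuous_on T (\<lambda>z. u (a z) (b z) (c z))"
proof -
  have "continuous_on T (\<lambda>z. (a z, b z, c z))"
    using assms(2-4) by (intro continuous_intros)
  then have "continuous_on T (\<lambda>z. (\<lambda>(t, x, \<xi>). u t x \<xi>) (a z, b z, c z))"
    by (rule continuous_on_compose2[OF assms(1)]) (use assms(5) in auto)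
  then show ?thesis by simp
qed

abbreviation ART_integrand ::
  "complex \<Rightarrow> (real \<Rightarrow> real ^ 3 \<Rightarrow> real ^ 3 \<Rightarrow> complex) \<Rightarrow> nat
     \<Rightarrow> real \<Rightarrow> real ^ 3 \<Rightarrow> real ^ 3 \<Rightarrow> real \<Rightarrow> complex" where
  "ART_integrand \<alpha> g k t x \<xi> s \<equiv>
     of_real (s ^ k) * exp (- \<alpha> * of_real s) * g (t - s) (x - s *\<^sub>R \<xi>) \<xi>"

lemma continuous_on_ART_integrand:
  assumes "finite_Ck K n g" and "continuous_on T a" and "continuous_on T b" and "continuous_on T c"
    and "continuous_on T \<sigma>" and "\<And>z. z \<in> T \<Longrightarrow> c z \<in> sphere 0 1"
  shows "continuous_on T (\<lambda>z. ART_integrand \<alpha> g k (a z) (b z) (c z) (\<sigma> z))"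
  by (intro continuous_intros continuous_on_unit_bundle_compose[OF finite_Ck_continuous[OF assms(1)]] assms(2-6))

text \<open>
  For \<open>s > L\<close> the point \<open>x - s \<xi>\<close> has norm at least \<open>s - \<bar>x\<bar> > R\<close> and has left \<open>K\<close>. The bound \<open>L\<close> may be
  any number from \<open>\<bar>x\<bar> + R\<close> on, so one interval serves all \<open>x\<close> in a bounded set.
\<close>

lemma
  assumes g: "finite_Ck K n g" and R: "\<And>y. y \<in> K \<Longrightarrow> norm y \<le> R" and \<xi>: "\<xi> \<in> sphere 0 1"
    and L: "norm x + R \<le> L"
  shows ART_integrable_bound: "set_integrable lborel {0..} (ART_integrand \<alpha> g k t x \<xi>)"
    and ART_eq_integral: "ART \<alpha> g k t x \<xi> = integral {0..L} (ART_integrand \<alpha> g k t x \<xi>)"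
proof -
  have vanish: "ART_integrand \<alpha> g k t x \<xi> s = 0" if "s > L" "s \<ge> 0" for s
  proof -
    have "norm (x - s *\<^sub>R \<xi>) \<ge> norm (s *\<^sub>R \<xi>) - norm x"
      by (metis norm_minus_commute norm_triangle_ineq2)
    then have "x - s *\<^sub>R \<xi> \<notin> K"
      using R[of "x - s *\<^sub>R \<xi>"] that L \<xi> by auto
    then show ?thesis
      using g \<xi> unfolding finite_Ck_def by auto
  qed
  have "(\<lambda>s. indicator {0..} s *\<^sub>R F s) = (\<lambda>s. indicator {0..L} s *\<^sub>R F s)"
    if "\<And>s. s > L \<Longrightarrow> s \<ge> 0 \<Longrightarrow> F s = 0" for F :: "real \<Rightarrow> complex"
    using that by (auto simp: fun_eq_iff indicator_def)
  from this[OF vanish]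
  have ind: "(\<lambda>s. indicator {0..} s *\<^sub>R ART_integrand \<alpha> g k t x \<xi> s) =
      (\<lambda>s. indicator {0..L} s *\<^sub>R ART_integrand \<alpha> g k t x \<xi> s)"
    by simp
  have int: "set_integrable lborel {0..L} (ART_integrand \<alpha> g k t x \<xi>)"
    by (intro borel_integrable_atLeastAtMost' continuous_on_ART_integrand[OF g] continuous_intros \<xi>)
  then show "set_integrable lborel {0..} (ART_integrand \<alpha> g k t x \<xi>)"
    unfolding set_integrable_def by (simp only: ind)
  show "ART \<alpha> g k t x \<xi> = integral {0..L} (ART_integrand \<alpha> g k t x \<xi>)"
    using set_borel_integral_eq_integral(2)[OF int]
    unfolding ART_def set_lebesgue_integral_def by (simp only: ind)
qed

lemma ART_integrable:
  assumes "finite_Ck K n g" and "bounded K" and "\<xi> \<in> sphere 0 1"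
  shows "set_integrable lborel {0..} (ART_integrand \<alpha> g k t x \<xi>)"
proof -
  obtain R where "\<And>y. y \<in> K \<Longrightarrow> norm y \<le> R"
    using \<open>bounded K\<close> by (meson bounded_iff)
  from ART_integrable_bound[OF assms(1) this assms(3) order_refl] show ?thesis by simp
qed

text \<open>
  Continuity is local, and over a ball in \<open>x\<close> the transform is an integral over one fixed interval.
\<close>

lemma continuous_on_ART:
  assumes g: "finite_Ck K n g" and "bounded K"
  shows "continuous_on unit_bundle (\<lambda>(t, x, \<xi>). ART \<alpha> g k t x \<xi>)"
  unfolding continuous_on_eq_continuous_within
proof
  fix z :: "real \<times> (real ^ 3) \<times> (real ^ 3)"
  assume z: "z \<in> unit_bundle"
  obtain R where R: "\<And>y. y \<in> K \<Longrightarrow> norm y \<le> R"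
    using \<open>bounded K\<close> by (meson bounded_iff)
  define B where "B = norm (fst (snd z)) + 1"
  let ?V = "UNIV \<times> ball 0 B \<times> (UNIV :: (real ^ 3) set) :: (real \<times> (real ^ 3) \<times> (real ^ 3)) set"
  have c: "continuous_on (?V \<inter> unit_bundle)
      (\<lambda>z. integral (cbox 0 (B + R)) (ART_integrand \<alpha> g k (fst z) (fst (snd z)) (snd (snd z))))"
    unfolding case_prod_unfold
    by (rule integral_continuous_on_param, unfold case_prod_unfold)
       (rule continuous_on_ART_integrand[OF g]; auto intro!: continuous_intros)
  have e: "ART \<alpha> g k (fst z) (fst (snd z)) (snd (snd z)) =
      integral (cbox 0 (B + R)) (ART_integrand \<alpha> g k (fst z) (fst (snd z)) (snd (snd z)))"
    if "z \<in> ?V \<inter> unit_bundle" for z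
    using that by (subst ART_eq_integral[OF g R, where L = "B + R"]) auto
  have "continuous_on (?V \<inter> unit_bundle) (\<lambda>(t, x, \<xi>). ART \<alpha> g k t x \<xi>)"
    unfolding case_prod_unfold by (rule iffD2[OF continuous_on_cong[OF refl e] c])
  moreover have zV: "z \<in> ?V" by (auto simp: B_def mem_Times_iff)
  ultimately have "continuous (at z within ?V \<inter> unit_bundle) (\<lambda>(t, x, \<xi>). ART \<alpha> g k t x \<xi>)"
    using z unfolding continuous_on_eq_continuous_within by blast
  moreover have "at z within ?V \<inter> unit_bundle = at z within unit_bundle"
    by (rule at_within_nhd[OF zV]) (auto intro!: open_Times)
  ultimately show "continuous (at z within unit_bundle) (\<lambda>(t, x, \<xi>). ART \<alpha> g k t x \<xi>)"
    by simp
qed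

text \<open>
  Translating \<open>(t, x)\<close> translates the source, so differentiating the transform differentiates the
  source under the integral sign.
\<close>

lemma ART_has_vector_derivative:
  assumes g: "finite_Ck K (Suc n) g" and "compact K" and \<xi>: "\<xi> \<in> sphere 0 1"
  shows "((\<lambda>h. ART \<alpha> g k (t + h * fst v) (x + h *\<^sub>R snd v) \<xi>) has_vector_derivative
      ART \<alpha> (partial v g) k (t + h * fst v) (x + h *\<^sub>R snd v) \<xi>) (at h)"
proof -
  note K = compact_imp_closed[OF \<open>compact K\<close>]
  note pg = finite_Ck_partial[OF g K]
  obtain R where R: "\<And>y. y \<in> K \<Longrightarrow> norm y \<le> R"
    using compact_imp_bounded[OF \<open>compact K\<close>] by (meson bounded_iff)
  \<comment> \<open>This upper limit of integration is valid for all parameters within distance 1 of \<open>h\<close>.\<close>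
  define L where "L = norm x + (\<bar>h\<bar> + 1) * norm (snd v) + R"
  have L: "norm (x + h' *\<^sub>R snd v) + R \<le> L" if "h' \<in> ball h 1" for h'
  proof -
    have "\<bar>h'\<bar> \<le> \<bar>h\<bar> + 1" using that by (auto simp: dist_real_def)
    then have "norm (h' *\<^sub>R snd v) \<le> (\<bar>h\<bar> + 1) * norm (snd v)"
      by (simp add: mult_right_mono)
    then show ?thesis
      unfolding L_def using norm_triangle_ineq[of x "h' *\<^sub>R snd v"] by linarith
  qed
  have "((\<lambda>h. integral (cbox 0 L) (ART_integrand \<alpha> g k (t + h * fst v) (x + h *\<^sub>R snd v) \<xi>))
      has_vector_derivative
      integral (cbox 0 L) (ART_integrand \<alpha> (partial v g) k (t + h * fst v) (x + h *\<^sub>R snd v) \<xi>))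
      (at h within ball h 1)"
  proof (rule leibniz_rule_vector_derivative)
    fix h' s :: real
    have "((\<lambda>h'. (t + h' * fst v - s, x + h' *\<^sub>R snd v - s *\<^sub>R \<xi>)) has_vector_derivative v)
        (at h' within ball h 1)"
      by (cases v) (auto intro!: derivative_eq_intros simp: has_real_derivative_iff_has_vector_derivative)
    from partial_line_has_vector_derivative[OF g K \<xi> this]
    show "((\<lambda>h'. ART_integrand \<alpha> g k (t + h' * fst v) (x + h' *\<^sub>R snd v) \<xi> s) has_vector_derivative
        ART_integrand \<alpha> (partial v g) k (t + h' * fst v) (x + h' *\<^sub>R snd v) \<xi> s)
        (at h' within ball h 1)"
      by (intro bounded_linear.has_vector_derivative[OF bounded_linear_mult_right]) simp
  next
    fix h' :: real
    show "ART_integrand \<alpha> g k (t + h' * fst v) (x + h' *\<^sub>R snd v) \<xi> integrable_on cbox 0 L"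
      by (intro integrable_continuous continuous_on_ART_integrand[OF g] continuous_intros \<xi>)
  next
    show "continuous_on (ball h 1 \<times> cbox 0 L)
        (\<lambda>(h', s). ART_integrand \<alpha> (partial v g) k (t + h' * fst v) (x + h' *\<^sub>R snd v) \<xi> s)"
      unfolding case_prod_unfold
      by (intro continuous_on_ART_integrand[OF pg] continuous_intros \<xi>)
  qed auto
  then have "((\<lambda>h. integral (cbox 0 L) (ART_integrand \<alpha> g k (t + h * fst v) (x + h *\<^sub>R snd v) \<xi>))
      has_vector_derivative
      ART \<alpha> (partial v g) k (t + h * fst v) (x + h *\<^sub>R snd v) \<xi>) (at h)"
    using ART_eq_integral[OF pg R \<xi> L] by (simp add: at_within_open[of _ "ball h 1"])
  then show ?thesis
  proof (rule has_vector_derivative_transform_within_open)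
    fix h' assume "h' \<in> ball h 1"
    then show "integral (cbox 0 L) (ART_integrand \<alpha> g k (t + h' * fst v) (x + h' *\<^sub>R snd v) \<xi>) =
        ART \<alpha> g k (t + h' * fst v) (x + h' *\<^sub>R snd v) \<xi>"
      using ART_eq_integral[OF g R \<xi> L] by simp
  qed auto
qed

text \<open>
  The transport equation, moved onto the source. It is the fundamental theorem of calculus for
  \<open>s \<mapsto> s\<^sup>k e\<^sup>-\<^sup>\<alpha>\<^sup>s g (t - s) (x - s \<xi>) \<xi>\<close> on \<open>[0, L]\<close>: the value at \<open>L\<close> is zero because the ray has left \<open>K\<close>,
  and the value at 0 is nonzero only for \<open>k = 0\<close>. For \<open>k = 0\<close> the first summand vanishes, whatever
  the truncated difference \<open>k - 1\<close> stands for.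
\<close>

lemma ART_transport:
  assumes g: "finite_Ck K (Suc n) g" and "compact K" and \<xi>: "\<xi> \<in> sphere 0 1"
  shows "ART \<alpha> (ray_derivative g) k t x \<xi> =
      of_nat k * ART \<alpha> g (k - 1) t x \<xi> + (if k = 0 then g t x \<xi> else 0)
      - ART \<alpha> (time_operator \<alpha> g) k t x \<xi>"
proof -
  note K = compact_imp_closed[OF \<open>compact K\<close>]
  note rg = finite_Ck_ray_derivative[OF g K] and tg = finite_Ck_time_operator[OF g K]
  obtain R where R: "\<And>y. y \<in> K \<Longrightarrow> norm y \<le> R"
    using compact_imp_bounded[OF \<open>compact K\<close>] by (meson bounded_iff)
  \<comment> \<open>The extra 1 makes the integrand vanish already at the end point \<open>L\<close>.\<close>
  define L where "L = norm x + \<bar>R\<bar> + 1"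
  have L: "norm x + R \<le> L" and "0 \<le> L" unfolding L_def by auto
  let ?F = "ART_integrand \<alpha> g k t x \<xi>"
  let ?F' = "\<lambda>s. of_nat k * ART_integrand \<alpha> g (k - 1) t x \<xi> s
      - ART_integrand \<alpha> (ray_derivative g) k t x \<xi> s
      - ART_integrand \<alpha> (time_operator \<alpha> g) k t x \<xi> s"
  have deriv: "(?F has_vector_derivative ?F' s) (at s within {0..L})" for s
  proof -
    have "((\<lambda>z. z ^ k * exp (- \<alpha> * z)) has_field_derivative
        of_nat k * of_real s ^ (k - 1) * exp (- \<alpha> * of_real s)
        - \<alpha> * (of_real s ^ k * exp (- \<alpha> * of_real s))) (at (of_real s))"
      by (auto intro!: derivative_eq_intros simp: algebra_simps)
    from has_vector_derivative_real_field[OF this]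
    have ker: "((\<lambda>s. of_real (s ^ k) * exp (- \<alpha> * of_real s)) has_vector_derivative
        of_nat k * of_real s ^ (k - 1) * exp (- \<alpha> * of_real s)
        - \<alpha> * (of_real s ^ k * exp (- \<alpha> * of_real s))) (at s within {0..L})"
      by simp
    have "((\<lambda>s. (t - s, x - s *\<^sub>R \<xi>)) has_vector_derivative (- 1, - \<xi>)) (at s within {0..L})"
      by (auto intro!: derivative_eq_intros)
    from partial_line_has_vector_derivative[OF g K \<xi> this]
    have ray: "((\<lambda>s. g (t - s) (x - s *\<^sub>R \<xi>) \<xi>) has_vector_derivative
        partial (- 1, - \<xi>) g (t - s) (x - s *\<^sub>R \<xi>) \<xi>) (at s within {0..L})"
      by simp
    have "partial (- 1, - \<xi>) g t' x' \<xi> =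
        - (ray_derivative g t' x' \<xi> + time_operator \<alpha> g t' x' \<xi> - \<alpha> * g t' x' \<xi>)" for t' x'
    proof -
      note lin = partial_linear[OF g K \<xi>, of t' x']
      have "(- 1, - \<xi>) = - ((1, 0) + (0 :: real, \<xi>))" by simp
      then have "partial (- 1, - \<xi>) g t' x' \<xi> = - (partial (1, 0) g t' x' \<xi> + partial (0, \<xi>) g t' x' \<xi>)"
        by (simp only: linear_neg[OF lin] linear_add[OF lin])
      then show ?thesis
        by (simp add: ray_derivative_eq[OF g K \<xi>] time_operator_eq[OF g K \<xi>])
    qed
    with has_vector_derivative_mult[OF ker ray] show ?thesis
      by (simp add: algebra_simps)
  qed
  have int: "ART_integrand \<alpha> h m t x \<xi> integrable_on {0..L}" if "finite_Ck K n h" for h m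
    by (intro integrable_continuous_interval continuous_on_ART_integrand[OF that] continuous_intros \<xi>)
  have "L *\<^sub>R \<xi> = x - (x - L *\<^sub>R \<xi>)" by simp
  then have "norm (L *\<^sub>R \<xi>) \<le> norm x + norm (x - L *\<^sub>R \<xi>)"
    by (metis norm_triangle_ineq4)
  then have "x - L *\<^sub>R \<xi> \<notin> K"
    using R[of "x - L *\<^sub>R \<xi>"] \<xi> by (auto simp: L_def)
  then have FL: "?F L = 0"
    using g \<xi> unfolding finite_Ck_def by auto
  have F0: "?F 0 = (if k = 0 then g t x \<xi> else 0)"
    by simp
  have FTC: "integral {0..L} ?F' = ?F L - ?F 0"
    by (intro integral_unique fundamental_theorem_of_calculus deriv \<open>0 \<le> L\<close>)
  have "integral {0..L} ?F' = of_nat k * integral {0..L} (ART_integrand \<alpha> g (k - 1) t x \<xi>)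
      - integral {0..L} (ART_integrand \<alpha> (ray_derivative g) k t x \<xi>)
      - integral {0..L} (ART_integrand \<alpha> (time_operator \<alpha> g) k t x \<xi>)"
    using int[OF finite_Ck_SucD[OF g], of "k - 1"] int[OF rg, of k] int[OF tg, of k]
    by (simp add: Henstock_Kurzweil_Integration.integral_diff integrable_diff integrable_on_mult_right)
  also have "\<dots> = of_nat k * ART \<alpha> g (k - 1) t x \<xi> - ART \<alpha> (ray_derivative g) k t x \<xi>
      - ART \<alpha> (time_operator \<alpha> g) k t x \<xi>"
    using ART_eq_integral[OF g R \<xi> L] ART_eq_integral[OF rg R \<xi> L] ART_eq_integral[OF tg R \<xi> L]
    by simp
  finally show ?thesis
    unfolding FTC FL F0 by algebra
qed

lemma ART_time_operator:
  assumes g: "finite_Ck K (Suc n) g" and "compact K" and \<xi>: "\<xi> \<in> sphere 0 1"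
  shows "ART \<alpha> (time_operator \<alpha> g) k t x \<xi> =
      ART \<alpha> (partial (1, 0) g) k t x \<xi> + \<alpha> * ART \<alpha> g k t x \<xi>"
proof -
  note K = compact_imp_closed[OF \<open>compact K\<close>] compact_imp_bounded[OF \<open>compact K\<close>]
  have "set_integrable lborel {0..} (ART_integrand \<alpha> g k t x \<xi>)"
    "set_integrable lborel {0..} (ART_integrand \<alpha> (partial (1, 0) g) k t x \<xi>)"
    by (rule ART_integrable[OF g K(2) \<xi>] ART_integrable[OF finite_Ck_partial[OF g K(1)] K(2) \<xi>])+
  then have "(LINT s:{0..}|lborel. ART_integrand \<alpha> (partial (1, 0) g) k t x \<xi> s +
        \<alpha> * ART_integrand \<alpha> g k t x \<xi> s) =
      ART \<alpha> (partial (1, 0) g) k t x \<xi> + \<alpha> * ART \<alpha> g k t x \<xi>"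
    unfolding ART_def by (subst set_integral_add) auto
  then show ?thesis
    unfolding ART_def time_operator_eq[OF g K(1) \<xi>] by (simp add: algebra_simps)
qed

lemma ART_ray_derivative:
  assumes g: "finite_Ck K (Suc n) g" and "compact K" and \<xi>: "\<xi> \<in> sphere 0 1"
  shows "ART \<alpha> (ray_derivative g) k t x \<xi> =
      (\<Sum>q\<in>UNIV. of_real (\<xi> $ q) * ART \<alpha> (partial (0, axis q 1) g) k t x \<xi>)"
proof -
  note K = compact_imp_closed[OF \<open>compact K\<close>] compact_imp_bounded[OF \<open>compact K\<close>]
  let ?I = "\<lambda>q. ART_integrand \<alpha> (partial (0, axis q 1) g) k t x \<xi>"
  have int: "set_integrable lborel {0..} (?I q)" for q
    by (rule ART_integrable[OF finite_Ck_partial[OF g K(1)] K(2) \<xi>])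
  have "set_integrable lborel {0..} (\<lambda>s. of_real (\<xi> $ q) * ?I q s)" for q
    by (rule set_integrable_mult_right) (rule int)
  then have "(LINT s:{0..}|lborel. (\<Sum>q\<in>UNIV. of_real (\<xi> $ q) * ?I q s)) =
      (\<Sum>q\<in>UNIV. LINT s:{0..}|lborel. of_real (\<xi> $ q) * ?I q s)"
    by (simp only: set_lebesgue_integral_def set_integrable_def scaleR_sum_right
        Bochner_Integration.integral_sum)
  also have "\<dots> = (\<Sum>q\<in>UNIV. of_real (\<xi> $ q) * ART \<alpha> (partial (0, axis q 1) g) k t x \<xi>)"
    by (simp add: ART_def)
  finally show ?thesis
    unfolding ART_def ray_derivative_eq_sum[OF g K(1) \<xi>]
    by (simp add: sum_distrib_left mult.left_commute)
qed

section \<open>Derivatives of angular moments\<close>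

text \<open>
  \<open>u'\<close> is the derivative of \<open>u\<close> in the direction \<open>v\<close> of space-time, with the joint continuity that
  the Leibniz rule over the sphere requires. Sources and their transforms both have such
  derivatives, so their moments can be treated together.
\<close>

definition has_partial ::
  "(real \<Rightarrow> real ^ 3 \<Rightarrow> real ^ 3 \<Rightarrow> complex) \<Rightarrow> real \<times> (real ^ 3)
     \<Rightarrow> (real \<Rightarrow> real ^ 3 \<Rightarrow> real ^ 3 \<Rightarrow> complex) \<Rightarrow> bool" where
  "has_partial u v u' \<longleftrightarrow>
     continuous_on unit_bundle (\<lambda>(t, x, \<xi>). u t x \<xi>) \<and>
     continuous_on unit_bundle (\<lambda>(t, x, \<xi>). u' t x \<xi>) \<and>
     (\<forall>t x h. \<forall>\<xi>\<in>sphere 0 1. ((\<lambda>h. u (t + h * fst v) (x + h *\<^sub>R snd v) \<xi>) has_vector_derivative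
        u' (t + h * fst v) (x + h *\<^sub>R snd v) \<xi>) (at h))"

lemma has_partial_finite_Ck:
  assumes g: "finite_Ck K (Suc n) g" and "compact K"
  shows "has_partial g v (partial v g)"
  unfolding has_partial_def
proof (intro conjI allI ballI)
  note K = compact_imp_closed[OF \<open>compact K\<close>]
  show "continuous_on unit_bundle (\<lambda>(t, x, \<xi>). g t x \<xi>)"
    by (rule finite_Ck_continuous[OF g])
  show "continuous_on unit_bundle (\<lambda>(t, x, \<xi>). partial v g t x \<xi>)"
    by (rule finite_Ck_continuous[OF finite_Ck_partial[OF g K]])
  fix t h :: real and x \<xi> :: "real ^ 3"
  assume \<xi>: "\<xi> \<in> sphere 0 1"
  have "((\<lambda>h. (t + h * fst v, x + h *\<^sub>R snd v)) has_vector_derivative v) (at h)"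
    by (cases v) (auto intro!: derivative_eq_intros simp: has_real_derivative_iff_has_vector_derivative)
  from partial_line_has_vector_derivative[OF g K \<xi> this]
  show "((\<lambda>h. g (t + h * fst v) (x + h *\<^sub>R snd v) \<xi>) has_vector_derivative
      partial v g (t + h * fst v) (x + h *\<^sub>R snd v) \<xi>) (at h)"
    by simp
qed

lemma has_partial_ART:
  assumes g: "finite_Ck K (Suc n) g" and "compact K"
  shows "has_partial (ART \<alpha> g k) v (ART \<alpha> (partial v g) k)"
  unfolding has_partial_def
  using continuous_on_ART[OF g] ART_has_vector_derivative[OF g \<open>compact K\<close>]
    continuous_on_ART[OF finite_Ck_partial[OF g compact_imp_closed[OF \<open>compact K\<close>]]]
    compact_imp_bounded[OF \<open>compact K\<close>]
  by blast

lemma continuous_on_monomial: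
  fixes c :: "'a::topological_space \<Rightarrow> real ^ 3"
  shows "continuous_on T c \<Longrightarrow> continuous_on T (\<lambda>z. \<Prod>i\<leftarrow>is. c z $ i)"
  by (induction "is") (auto intro!: continuous_intros)

lemma sphere_integrable_moment:
  fixes u :: "real \<Rightarrow> real ^ 3 \<Rightarrow> real ^ 3 \<Rightarrow> complex"
  assumes "continuous_on unit_bundle (\<lambda>(t, x, \<xi>). u t x \<xi>)"
  shows "integrable sphere_measure (\<lambda>\<xi>. u t x \<xi> * of_real (\<Prod>i\<leftarrow>is. \<xi> $ i))"
  by (intro sphere_integrable continuous_intros continuous_on_monomial
      continuous_on_unit_bundle_compose[OF assms]) auto

lemma angular_moment_cong:
  assumes "\<And>\<xi>. \<xi> \<in> sphere 0 1 \<Longrightarrow> u t x \<xi> = w t x \<xi>"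
  shows "angular_moment p u t x is = angular_moment p w t x is"
proof -
  have "space sphere_measure = sphere 0 1"
    by (simp add: sphere_measure_def space_restrict_space)
  then show ?thesis
    unfolding angular_moment_def using assms
    by (auto intro!: Bochner_Integration.integral_cong)
qed

lemma angular_moment_linear:
  assumes "continuous_on unit_bundle (\<lambda>(t, x, \<xi>). u t x \<xi>)"
    and "continuous_on unit_bundle (\<lambda>(t, x, \<xi>). w t x \<xi>)"
  shows "angular_moment p (\<lambda>t x \<xi>. c * u t x \<xi> + d * w t x \<xi>) t x is =
      c * angular_moment p u t x is + d * angular_moment p w t x is"
proof -
  have "(LINT \<xi>|sphere_measure. c * (u t x \<xi> * of_real (\<Prod>i\<leftarrow>is. \<xi> $ i))
        + d * (w t x \<xi> * of_real (\<Prod>i\<leftarrow>is. \<xi> $ i))) =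
      c * (LINT \<xi>|sphere_measure. u t x \<xi> * of_real (\<Prod>i\<leftarrow>is. \<xi> $ i))
        + d * (LINT \<xi>|sphere_measure. w t x \<xi> * of_real (\<Prod>i\<leftarrow>is. \<xi> $ i))"
    using sphere_integrable_moment[OF assms(1), of t x "is"]
      sphere_integrable_moment[OF assms(2), of t x "is"]
    by (subst Bochner_Integration.integral_add) auto
  then show ?thesis
    by (simp add: angular_moment_def algebra_simps)
qed

lemma angular_moment_has_vector_derivative:
  assumes "has_partial u v u'"
  shows "((\<lambda>h. angular_moment p u (t + h * fst v) (x + h *\<^sub>R snd v) is) has_vector_derivative
      angular_moment p u' (t + h * fst v) (x + h *\<^sub>R snd v) is) (at h)"
proof (cases "length is = p")
  case True
  have u: "continuous_on unit_bundle (\<lambda>(t, x, \<xi>). u t x \<xi>)"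
    and u': "continuous_on unit_bundle (\<lambda>(t, x, \<xi>). u' t x \<xi>)"
    and deriv: "\<And>t x h \<xi>. \<xi> \<in> sphere 0 1 \<Longrightarrow>
      ((\<lambda>h. u (t + h * fst v) (x + h *\<^sub>R snd v) \<xi>) has_vector_derivative
        u' (t + h * fst v) (x + h *\<^sub>R snd v) \<xi>) (at h)"
    using assms unfolding has_partial_def by blast+
  have "((\<lambda>h. LINT \<xi>|sphere_measure.
        u (t + h * fst v) (x + h *\<^sub>R snd v) \<xi> * of_real (\<Prod>i\<leftarrow>is. \<xi> $ i)) has_vector_derivative
      (LINT \<xi>|sphere_measure.
        u' (t + h * fst v) (x + h *\<^sub>R snd v) \<xi> * of_real (\<Prod>i\<leftarrow>is. \<xi> $ i))) (at h)"
  proof (rule sphere_integral_has_vector_derivative)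
    fix h :: real
    show "continuous_on (sphere 0 1)
        (\<lambda>\<xi>. u (t + h * fst v) (x + h *\<^sub>R snd v) \<xi> * of_real (\<Prod>i\<leftarrow>is. \<xi> $ i))"
      by (intro continuous_intros continuous_on_monomial continuous_on_unit_bundle_compose[OF u]) auto
  next
    show "continuous_on (UNIV \<times> sphere 0 1)
        (\<lambda>(h, \<xi>). u' (t + h * fst v) (x + h *\<^sub>R snd v) \<xi> * of_real (\<Prod>i\<leftarrow>is. \<xi> $ i))"
      unfolding case_prod_unfold
      by (intro continuous_intros continuous_on_monomial continuous_on_unit_bundle_compose[OF u']) auto
  next
    fix h :: real and \<xi> :: "real ^ 3" assume "\<xi> \<in> sphere 0 1"
    then show "((\<lambda>h. u (t + h * fst v) (x + h *\<^sub>R snd v) \<xi> * of_real (\<Prod>i\<leftarrow>is. \<xi> $ i))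
        has_vector_derivative
        u' (t + h * fst v) (x + h *\<^sub>R snd v) \<xi> * of_real (\<Prod>i\<leftarrow>is. \<xi> $ i)) (at h)"
      by (intro bounded_linear.has_vector_derivative[OF bounded_linear_mult_left] deriv)
  qed
  with True show ?thesis by (simp add: angular_moment_def)
qed (simp add: angular_moment_def)

lemma angular_moment_time_derivative:
  assumes "has_partial u (1, 0) u'"
  shows "((\<lambda>\<tau>. angular_moment p u \<tau> x is) has_vector_derivative angular_moment p u' t x is) (at t)"
  using angular_moment_has_vector_derivative[OF assms, of p 0 x "is" t] by simp

lemma has_partial_continuous:
  assumes "has_partial u v u'"
  shows "continuous_on unit_bundle (\<lambda>(t, x, \<xi>). u t x \<xi>)"
    and "continuous_on unit_bundle (\<lambda>(t, x, \<xi>). u' t x \<xi>)"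
  using assms unfolding has_partial_def by blast+

lemma dt_plus_angular_moment:
  assumes u: "has_partial u (1, 0) u'"
    and w: "\<And>t x \<xi>. \<xi> \<in> sphere 0 1 \<Longrightarrow> w t x \<xi> = u' t x \<xi> + \<alpha> * u t x \<xi>"
  shows "dt_plus \<alpha> (angular_moment p u) = angular_moment p w"
proof (intro ext)
  fix t x "is"
  have "angular_moment p w t x is = angular_moment p (\<lambda>t x \<xi>. 1 * u' t x \<xi> + \<alpha> * u t x \<xi>) t x is"
    by (rule angular_moment_cong) (simp add: w)
  also have "\<dots> = angular_moment p u' t x is + \<alpha> * angular_moment p u t x is"
    by (subst angular_moment_linear[OF has_partial_continuous(2,1)[OF u]]) simp
  finally show "dt_plus \<alpha> (angular_moment p u) t x is = angular_moment p w t x is"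
    using vector_derivative_at[OF angular_moment_time_derivative[OF u, of p x "is" t]]
    by (simp add: dt_plus_def)
qed

text \<open>
  The index over which the divergence contracts contributes the factor \<open>\<xi>\<^sup>q\<close> to the moment, and
  \<open>\<Sum>\<^sub>q \<xi>\<^sup>q \<partial>\<^sub>q\<close> is the ray derivative. On index lists of the wrong length both sides are zero, so
  this is an equality of tensor fields and can be iterated.
\<close>

lemma divergence_angular_moment:
  assumes u: "\<And>q. has_partial u (0, axis q 1) (u' q)"
    and w: "\<And>t x \<xi>. \<xi> \<in> sphere 0 1 \<Longrightarrow> w t x \<xi> = (\<Sum>q\<in>UNIV. of_real (\<xi> $ q) * u' q t x \<xi>)"
  shows "divergence (angular_moment (Suc p) u) = angular_moment p w"
proof (intro ext)
  fix t x "is"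
  have "divergence (angular_moment (Suc p) u) t x is =
      (\<Sum>q\<in>UNIV. angular_moment (Suc p) (u' q) t x (is @ [q]))"
    unfolding divergence_def
    using angular_moment_has_vector_derivative[OF u, where p = "Suc p" and t = t and x = x and h = 0]
    by (intro sum.cong refl vector_derivative_at) simp
  also have "\<dots> = angular_moment p (\<lambda>t x \<xi>. \<Sum>q\<in>UNIV. of_real (\<xi> $ q) * u' q t x \<xi>) t x is"
  proof (cases "length is = p")
    case True
    have "(\<Sum>q\<in>UNIV. (LINT \<xi>|sphere_measure. u' q t x \<xi> * of_real (\<Prod>i\<leftarrow>is @ [q]. \<xi> $ i))) =
        (LINT \<xi>|sphere_measure. (\<Sum>q\<in>UNIV. u' q t x \<xi> * of_real (\<Prod>i\<leftarrow>is @ [q]. \<xi> $ i)))"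
      by (intro Bochner_Integration.integral_sum[symmetric] sphere_integrable_moment
            has_partial_continuous(2)[OF u])
    also have "\<dots> = (LINT \<xi>|sphere_measure.
        (\<Sum>q\<in>UNIV. of_real (\<xi> $ q) * u' q t x \<xi>) * of_real (\<Prod>i\<leftarrow>is. \<xi> $ i))"
      by (simp add: sum_distrib_left sum_distrib_right algebra_simps)
    finally show ?thesis using True by (simp add: angular_moment_def)
  qed (simp add: angular_moment_def)
  also have "\<dots> = angular_moment p w t x is"
    by (rule angular_moment_cong) (simp add: w)
  finally show "divergence (angular_moment (Suc p) u) t x is = angular_moment p w t x is" .
qed

section \<open>Operators on moments as operators on sources\<close>

lemma finite_Ck_ray_derivative_power:
  assumes "closed K" and "finite_Ck K (n + m) g"
  shows "finite_Ck K m ((ray_derivative ^^ n) g)"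
  using assms(2)
  by (induction n arbitrary: m) (auto intro!: finite_Ck_ray_derivative[OF _ assms(1)] simp flip: add_Suc_right)

lemma finite_Ck_time_operator_power:
  assumes "closed K" and "finite_Ck K (n + m) g"
  shows "finite_Ck K m ((time_operator \<alpha> ^^ n) g)"
  using assms(2)
  by (induction n arbitrary: m) (auto intro!: finite_Ck_time_operator[OF _ assms(1)] simp flip: add_Suc_right)

lemma dt_plus_ART_moment:
  assumes "finite_Ck K (Suc n) g" and "compact K"
  shows "dt_plus \<alpha> (ART_moment \<alpha> g k p) = ART_moment \<alpha> (time_operator \<alpha> g) k p"
  unfolding ART_moment_def
  by (rule dt_plus_angular_moment[OF has_partial_ART[OF assms] ART_time_operator[OF assms]])

lemma dt_plus_source_moment:
  assumes "finite_Ck K (Suc n) g" and "compact K"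
  shows "dt_plus \<alpha> (angular_moment p g) = angular_moment p (time_operator \<alpha> g)"
  by (rule dt_plus_angular_moment[OF has_partial_finite_Ck[OF assms]
        time_operator_eq[OF assms(1) compact_imp_closed[OF assms(2)]]])

lemma divergence_ART_moment:
  assumes "finite_Ck K (Suc n) g" and "compact K"
  shows "divergence (ART_moment \<alpha> g k (Suc p)) = ART_moment \<alpha> (ray_derivative g) k p"
  unfolding ART_moment_def
  by (rule divergence_angular_moment[OF has_partial_ART[OF assms] ART_ray_derivative[OF assms]])

lemma dt_plus_power_ART_moment:
  assumes "compact K" and "finite_Ck K (j + m) g"
  shows "(dt_plus \<alpha> ^^ j) (ART_moment \<alpha> g k p) = ART_moment \<alpha> ((time_operator \<alpha> ^^ j) g) k p"
  using assms(2)
proof (induction j arbitrary: m)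
  case (Suc j)
  have "finite_Ck K (Suc m) ((time_operator \<alpha> ^^ j) g)"
    using Suc.prems by (intro finite_Ck_time_operator_power compact_imp_closed assms(1)) simp
  from dt_plus_ART_moment[OF this assms(1)] Suc.IH[of "Suc m"] Suc.prems show ?case by simp
qed simp

lemma dt_plus_power_source_moment:
  assumes "compact K" and "finite_Ck K (j + m) g"
  shows "(dt_plus \<alpha> ^^ j) (angular_moment p g) = angular_moment p ((time_operator \<alpha> ^^ j) g)"
  using assms(2)
proof (induction j arbitrary: m)
  case (Suc j)
  have "finite_Ck K (Suc m) ((time_operator \<alpha> ^^ j) g)"
    using Suc.prems by (intro finite_Ck_time_operator_power compact_imp_closed assms(1)) simp
  from dt_plus_source_moment[OF this assms(1)] Suc.IH[of "Suc m"] Suc.prems show ?case by simp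
qed simp

lemma divergence_power_ART_moment:
  assumes "compact K" and "finite_Ck K (n + m) g"
  shows "(divergence ^^ n) (ART_moment \<alpha> g k (p + n)) = ART_moment \<alpha> ((ray_derivative ^^ n) g) k p"
  using assms(2)
proof (induction n arbitrary: m p)
  case (Suc n)
  have "finite_Ck K (Suc m) ((ray_derivative ^^ n) g)"
    using Suc.prems by (intro finite_Ck_ray_derivative_power compact_imp_closed assms(1)) simp
  from divergence_ART_moment[OF this assms(1)] Suc.IH[of "Suc m" "Suc p"] Suc.prems
  show ?case by simp
qed simp

text \<open>
  Differentiability in \<open>t\<close> is what allows \<open>\<partial>/\<partial>t + \<alpha>\<close> to be distributed over the sums produced by
  the induction.
\<close>

lemma ART_moment_differentiable:
  assumes "compact K" and "finite_Ck K (Suc j) g"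
  shows "(\<lambda>\<tau>. (dt_plus \<alpha> ^^ j) (ART_moment \<alpha> g k p) \<tau> x is) differentiable (at t)"
proof -
  have "finite_Ck K (Suc 0) ((time_operator \<alpha> ^^ j) g)"
    using assms by (intro finite_Ck_time_operator_power compact_imp_closed) auto
  note u = has_partial_ART[OF this assms(1)]
  have eq: "(dt_plus \<alpha> ^^ j) (ART_moment \<alpha> g k p) =
      angular_moment p (ART \<alpha> ((time_operator \<alpha> ^^ j) g) k)"
    using dt_plus_power_ART_moment[OF assms(1), of j 1 g] assms(2) by (simp add: ART_moment_def)
  show ?thesis
    unfolding eq by (rule differentiableI_vector[OF angular_moment_time_derivative[OF u]])
qed

lemma source_moment_differentiable:
  assumes "compact K" and "finite_Ck K (Suc j) g"
  shows "(\<lambda>\<tau>. (dt_plus \<alpha> ^^ j) (angular_moment p g) \<tau> x is) differentiable (at t)"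
proof -
  have "finite_Ck K (Suc 0) ((time_operator \<alpha> ^^ j) g)"
    using assms by (intro finite_Ck_time_operator_power compact_imp_closed) auto
  note u = has_partial_finite_Ck[OF this assms(1)]
  have eq: "(dt_plus \<alpha> ^^ j) (angular_moment p g) = angular_moment p ((time_operator \<alpha> ^^ j) g)"
    using dt_plus_power_source_moment[OF assms(1), of j 1 g] assms(2) by simp
  show ?thesis
    unfolding eq by (rule differentiableI_vector[OF angular_moment_time_derivative[OF u]])
qed

lemma dt_plus_add:
  assumes "(\<lambda>\<tau>. v \<tau> x is) differentiable (at t)" and "(\<lambda>\<tau>. w \<tau> x is) differentiable (at t)"
  shows "dt_plus \<alpha> (\<lambda>t x is. v t x is + w t x is) t x is = dt_plus \<alpha> v t x is + dt_plus \<alpha> w t x is"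
  using assms by (simp add: dt_plus_def vector_derivative_add_at algebra_simps)

lemma dt_plus_mult:
  assumes "(\<lambda>\<tau>. w \<tau> x is) differentiable (at t)"
  shows "dt_plus \<alpha> (\<lambda>t x is. c * w t x is) t x is = c * dt_plus \<alpha> w t x is"
  using assms by (simp add: dt_plus_def vector_derivative_mult_at algebra_simps)

lemma dt_plus_sum:
  assumes "finite J" and "\<And>j. j \<in> J \<Longrightarrow> (\<lambda>\<tau>. w j \<tau> x is) differentiable (at t)"
  shows "dt_plus \<alpha> (\<lambda>t x is. \<Sum>j\<in>J. c j * w j t x is) t x is = (\<Sum>j\<in>J. c j * dt_plus \<alpha> (w j) t x is)"
  using assms
proof (induction J rule: finite_induct)
  case empty
  then show ?case by (simp add: dt_plus_def)
next
  case (insert i J)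
  have "dt_plus \<alpha> (\<lambda>t x is. c i * w i t x is + (\<Sum>j\<in>J. c j * w j t x is)) t x is =
      dt_plus \<alpha> (\<lambda>t x is. c i * w i t x is) t x is
      + dt_plus \<alpha> (\<lambda>t x is. \<Sum>j\<in>J. c j * w j t x is) t x is"
    using insert by (intro dt_plus_add differentiable_mult differentiable_sum) auto
  then show ?case
    using insert by (simp add: dt_plus_mult)
qed

section \<open>The recursion in the order of the divergence\<close>

lemma sum_binomial_Pascal:
  fixes a :: "nat \<Rightarrow> 'a::comm_semiring_1"
  shows "(\<Sum>j\<le>Suc n. of_nat (Suc n choose j) * a j) =
      (\<Sum>j\<le>n. of_nat (n choose j) * a j) + (\<Sum>j\<le>n. of_nat (n choose j) * a (Suc j))"
proof -
  have "(\<Sum>j\<le>Suc n. of_nat (Suc n choose j) * a j) =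
      a 0 + (\<Sum>j\<le>n. of_nat (n choose Suc j) * a (Suc j)) + (\<Sum>j\<le>n. of_nat (n choose j) * a (Suc j))"
    by (simp add: sum.atMost_Suc_shift sum.distrib algebra_simps del: sum.atMost_Suc)
  also have "a 0 + (\<Sum>j\<le>n. of_nat (n choose Suc j) * a (Suc j)) = (\<Sum>j\<le>Suc n. of_nat (n choose j) * a j)"
    by (simp add: sum.atMost_Suc_shift del: sum.atMost_Suc)
  also have "\<dots> = (\<Sum>j\<le>n. of_nat (n choose j) * a j)"
    by (simp add: binomial_eq_0)
  finally show ?thesis .
qed

text \<open>
  The transport identity integrated over the sphere. It lowers the power of the ray derivative by
  one, at the cost of one step down in the order of the transform or one outer factor
  \<open>\<partial>/\<partial>t + \<alpha>\<close>.
\<close>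

lemma ART_moment_ray_derivative:
  assumes g: "finite_Ck K (Suc n) g" and "compact K"
  shows "ART_moment \<alpha> (ray_derivative g) (Suc k) p t x is =
      of_nat (Suc k) * ART_moment \<alpha> g k p t x is - dt_plus \<alpha> (ART_moment \<alpha> g (Suc k) p) t x is"
    and "ART_moment \<alpha> (ray_derivative g) 0 p t x is =
      angular_moment p g t x is - dt_plus \<alpha> (ART_moment \<alpha> g 0 p) t x is"
proof -
  note K = compact_imp_closed[OF \<open>compact K\<close>] compact_imp_bounded[OF \<open>compact K\<close>]
  note cont = continuous_on_ART[OF finite_Ck_time_operator[OF g K(1)] K(2)]
  have "ART_moment \<alpha> (ray_derivative g) (Suc k) p t x is = angular_moment p
      (\<lambda>t x \<xi>. of_nat (Suc k) * ART \<alpha> g k t x \<xi> + (- 1) * ART \<alpha> (time_operator \<alpha> g) (Suc k) t x \<xi>)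
      t x is"
    unfolding ART_moment_def
    by (rule angular_moment_cong) (simp add: ART_transport[OF g \<open>compact K\<close>])
  then show "ART_moment \<alpha> (ray_derivative g) (Suc k) p t x is =
      of_nat (Suc k) * ART_moment \<alpha> g k p t x is - dt_plus \<alpha> (ART_moment \<alpha> g (Suc k) p) t x is"
    unfolding dt_plus_ART_moment[OF g \<open>compact K\<close>]
    unfolding ART_moment_def angular_moment_linear[OF continuous_on_ART[OF g K(2)] cont]
    by simp
  have "ART_moment \<alpha> (ray_derivative g) 0 p t x is = angular_moment p
      (\<lambda>t x \<xi>. 1 * g t x \<xi> + (- 1) * ART \<alpha> (time_operator \<alpha> g) 0 t x \<xi>) t x is"
    unfolding ART_moment_def
    by (rule angular_moment_cong) (simp add: ART_transport[OF g \<open>compact K\<close>])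
  then show "ART_moment \<alpha> (ray_derivative g) 0 p t x is =
      angular_moment p g t x is - dt_plus \<alpha> (ART_moment \<alpha> g 0 p) t x is"
    unfolding dt_plus_ART_moment[OF g \<open>compact K\<close>]
    unfolding ART_moment_def angular_moment_linear[OF finite_Ck_continuous[OF g] cont]
    by simp
qed

text \<open>
  In the induction step the first term of the recursion uses the hypothesis for \<open>k\<close> and the
  second one for \<open>k + 1\<close>, since the order \<open>k + (n + 1)\<close> of the transform is \<open>(k + 1) + n\<close>. After
  the common factor \<open>(-1)\<^sup>j (k + n + 1)! / (k + j)!\<close> is absorbed into the \<open>j\<close>-th summand, the two
  sums differ by an index shift and Pascal's rule joins them.
\<close>

lemma ART_moment_ray_derivative_power:
  assumes "compact K" and "finite_Ck K n f"
  shows "ART_moment \<alpha> ((ray_derivative ^^ n) f) (k + n) p t x is =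
      (\<Sum>j\<le>n. (- 1) ^ j * of_nat (n choose j) * (fact (k + n) / fact (k + j)) *
        (dt_plus \<alpha> ^^ j) (ART_moment \<alpha> f (k + j) p) t x is)"
  using assms(2)
proof (induction n arbitrary: k t x "is")
  case (Suc n)
  note f = finite_Ck_SucD[OF Suc.prems]
  let ?H = "(ray_derivative ^^ n) f"
  let ?W = "\<lambda>k j. (dt_plus \<alpha> ^^ j) (ART_moment \<alpha> f (k + j) p)"
  define a where "a = (\<lambda>j. (- 1) ^ j * (fact (k + Suc n) / fact (k + j)) * ?W k j t x is)"
  have "finite_Ck K (Suc 0) ?H"
    using Suc.prems by (intro finite_Ck_ray_derivative_power compact_imp_closed assms(1)) simp
  from ART_moment_ray_derivative(1)[OF this assms(1), of \<alpha> "k + n" p t x "is"]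
  have "ART_moment \<alpha> ((ray_derivative ^^ Suc n) f) (k + Suc n) p t x is =
      of_nat (Suc (k + n)) * ART_moment \<alpha> ?H (k + n) p t x is
      - dt_plus \<alpha> (ART_moment \<alpha> ?H (Suc k + n) p) t x is"
    by simp
  also have "of_nat (Suc (k + n)) * ART_moment \<alpha> ?H (k + n) p t x is =
      (\<Sum>j\<le>n. of_nat (n choose j) * a j)"
    unfolding Suc.IH[OF f] sum_distrib_left by (simp add: a_def mult_ac)
  also have "dt_plus \<alpha> (ART_moment \<alpha> ?H (Suc k + n) p) t x is =
      dt_plus \<alpha> (\<lambda>t x is. \<Sum>j\<le>n. (- 1) ^ j * of_nat (n choose j) *
        (fact (Suc k + n) / fact (Suc k + j)) * ?W (Suc k) j t x is) t x is"
    by (rule arg_cong[of _ _ "\<lambda>w. dt_plus \<alpha> w t x is"]) (intro ext Suc.IH[OF f])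
  also have "\<dots> = (\<Sum>j\<le>n. (- 1) ^ j * of_nat (n choose j) *
        (fact (Suc k + n) / fact (Suc k + j)) * dt_plus \<alpha> (?W (Suc k) j) t x is)"
  proof (rule dt_plus_sum)
    fix j assume "j \<in> {..n}"
    then have "finite_Ck K (Suc j) f"
      using finite_Ck_mono[OF _ Suc.prems, of "Suc j"] by simp
    then show "(\<lambda>\<tau>. ?W (Suc k) j \<tau> x is) differentiable (at t)"
      by (rule ART_moment_differentiable[OF assms(1)])
  qed simp
  also have "\<dots> = - (\<Sum>j\<le>n. of_nat (n choose j) * a (Suc j))"
    by (simp add: a_def mult_ac flip: sum_negf)
  also have "(\<Sum>j\<le>n. of_nat (n choose j) * a j) - - (\<Sum>j\<le>n. of_nat (n choose j) * a (Suc j)) =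
      (\<Sum>j\<le>Suc n. of_nat (Suc n choose j) * a j)"
    unfolding sum_binomial_Pascal by simp
  finally show ?case
    by (simp add: a_def mult_ac del: sum.atMost_Suc binomial_Suc_Suc)
qed simp

text \<open>
  At order 0 the transport identity leaves the source itself instead of a transform of lower
  order, so each step contributes one moment of a power of the ray derivative of \<open>f\<close>.
\<close>

lemma ART_moment_0_ray_derivative_power:
  assumes "compact K" and "finite_Ck K n f"
  shows "ART_moment \<alpha> ((ray_derivative ^^ n) f) 0 p t x is =
      (\<Sum>j<n. (- 1) ^ j *
        (dt_plus \<alpha> ^^ j) (angular_moment p ((ray_derivative ^^ (n - j - 1)) f)) t x is)
      + (- 1) ^ n * (dt_plus \<alpha> ^^ n) (ART_moment \<alpha> f 0 p) t x is"
  using assms(2)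
proof (induction n arbitrary: t x "is")
  case (Suc n)
  note f = finite_Ck_SucD[OF Suc.prems]
  let ?H = "\<lambda>m. (ray_derivative ^^ m) f"
  let ?V = "\<lambda>j. (dt_plus \<alpha> ^^ j) (angular_moment p (?H (n - j - 1)))"
  let ?W = "(dt_plus \<alpha> ^^ n) (ART_moment \<alpha> f 0 p)"
  have V: "(\<lambda>\<tau>. ?V j \<tau> x is) differentiable (at t)" if "j < n" for j
  proof -
    have "finite_Ck K ((n - j - 1) + Suc j) f"
      using that f by simp
    from finite_Ck_ray_derivative_power[OF compact_imp_closed[OF assms(1)] this]
    show ?thesis by (rule source_moment_differentiable[OF assms(1)])
  qed
  have W: "(\<lambda>\<tau>. ?W \<tau> x is) differentiable (at t)"
    by (rule ART_moment_differentiable[OF assms(1) Suc.prems])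
  have "finite_Ck K (Suc 0) (?H n)"
    using Suc.prems by (intro finite_Ck_ray_derivative_power compact_imp_closed assms(1)) simp
  from ART_moment_ray_derivative(2)[OF this assms(1), of \<alpha> p t x "is"]
  have "ART_moment \<alpha> (?H (Suc n)) 0 p t x is =
      angular_moment p (?H n) t x is - dt_plus \<alpha> (ART_moment \<alpha> (?H n) 0 p) t x is"
    by simp
  also have "dt_plus \<alpha> (ART_moment \<alpha> (?H n) 0 p) t x is =
      dt_plus \<alpha> (\<lambda>t x is. (\<Sum>j<n. (- 1) ^ j * ?V j t x is) + (- 1) ^ n * ?W t x is) t x is"
    by (rule arg_cong[of _ _ "\<lambda>w. dt_plus \<alpha> w t x is"]) (intro ext Suc.IH[OF f])
  also have "\<dots> = dt_plus \<alpha> (\<lambda>t x is. \<Sum>j<n. (- 1) ^ j * ?V j t x is) t x is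
      + dt_plus \<alpha> (\<lambda>t x is. (- 1) ^ n * ?W t x is) t x is"
    using V W by (intro dt_plus_add differentiable_sum ballI differentiable_mult) auto
  also have "\<dots> = (\<Sum>j<n. (- 1) ^ j * dt_plus \<alpha> (?V j) t x is) + (- 1) ^ n * dt_plus \<alpha> ?W t x is"
    using V W dt_plus_sum[where J = "{..<n}" and w = ?V and c = "\<lambda>j. (- 1) ^ j"]
    by (simp add: dt_plus_mult)
  finally show ?case
    by (simp add: sum.lessThan_Suc_shift sum_negf del: sum.lessThan_Suc)
qed simp

theorem theorem4p3:
  fixes D :: "(real ^ 3) set"
    and f :: "real \<Rightarrow> real ^ 3 \<Rightarrow> real ^ 3 \<Rightarrow> complex"
    and k n p :: nat
    and \<epsilon> \<kappa> :: real
    and \<alpha> :: complex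
  assumes "open D" and "D \<noteq> {}" and "bounded D" and "convex D" and "smooth_boundary D"
    and "n \<ge> 1"
    and "\<epsilon> \<ge> 0"
    and "\<alpha> = of_real \<epsilon> + \<i> * of_real \<kappa>"
    and "Ck_on_subset n (\<lambda>(t, x, \<xi>). f t x \<xi>) (UNIV \<times> D \<times> sphere 0 1)"
    and "bounded ((\<lambda>(t, x, \<xi>). f t x \<xi>) ` (UNIV \<times> D \<times> sphere 0 1))"
    and "\<exists>K. compact K \<and> K \<subseteq> D \<and> (\<forall>t x. \<forall>\<xi>\<in>sphere 0 1. x \<notin> K \<longrightarrow> f t x \<xi> = 0)"
  shows
    "(k \<ge> 1 \<longrightarrow>
       (\<forall>t x is. length is = p \<longrightarrow>
          (divergence ^^ n) (ART_moment \<alpha> f (k + n) (p + n)) t x is =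
          (\<Sum>j=0..n. (- 1) ^ j * of_nat (n choose j) * (fact (k + n) / fact (k + j)) *
             (dt_plus \<alpha> ^^ j) (ART_moment \<alpha> f (k + j) p) t x is)))
     \<and>
     (\<forall>t x is. length is = p \<longrightarrow>
        (divergence ^^ n) (ART_moment \<alpha> f 0 (p + n)) t x is =
        (\<Sum>j=0..n - 1. (- 1) ^ j *
           (dt_plus \<alpha> ^^ j) (angular_moment p ((ray_derivative ^^ (n - j - 1)) f)) t x is)
        + (- 1) ^ n * (dt_plus \<alpha> ^^ n) (ART_moment \<alpha> f 0 p) t x is)"
proof -
  obtain K where K: "compact K" "K \<subseteq> D" "\<forall>t x. \<forall>\<xi>\<in>sphere 0 1. x \<notin> K \<longrightarrow> f t x \<xi> = 0"
    using assms(11) by blast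
  have f: "finite_Ck K n f"
    by (rule finite_Ck_zero_extension[OF assms(9,1) compact_imp_closed[OF K(1)] K(2)]) (use K(3) in blast)
  have div: "(divergence ^^ n) (ART_moment \<alpha> f m (p + n)) = ART_moment \<alpha> ((ray_derivative ^^ n) f) m p"
    for m
    using divergence_power_ART_moment[OF K(1), of n 0] f by simp
  have "{0..n - 1} = {..<n}"
    using \<open>n \<ge> 1\<close> by auto
  then show ?thesis
    unfolding div
    by (simp only: ART_moment_ray_derivative_power[OF K(1) f]
        ART_moment_0_ray_derivative_power[OF K(1) f] atMost_atLeast0) simp
qed

end
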